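(* Let $G=(V,E)$ be a simple directed graph with $V=\{1,\dots,n\}$ and let $f\ge 0$ be an integer. Asynchronous approximate consensus is possible in network $G$ in the presence of up to $f$ Byzantine faults if and only if $G$ satisfies the 3-reach condition: for any nodes $u,v\in V$ and any node subsets $F,F_u,F_v\subseteq V$ with $|F|,|F_u|,|F_v|\le f$, $u\notin F\cup F_u$ and $v\notin F\cup F_v$, we have $$reach_v(F\cup F_v)\cap reach_u(F\cup F_u)\neq\emptyset.$$
   Context: System model: $n$ nodes communicate by message passing over the directed graph $G$; node $i$ can reliably send messages to node $j$ iff $(i,j)\in E$ (self-loops are excluded from $E$, but each node can send messages to itself). The system is asynchronous: links are reliable but message delays are finite and not known a priori. At most $f$ nodes may be Byzantine faulty, i.e., behave arbitrarily and possibly collude. Approximate consensus: each node gets a real-valued input, and for a given $\epsilon>0$ an algorithm must guarantee (Convergence) the outputs of any two nonfaulty nodes are within $\epsilon$ of each other; (Validity) the output of every nonfaulty node lies within the range of the inputs of the nonfaulty nodes; (Termination) all nonfaulty nodes eventually output a value. For $Y\subseteq V$, $G_Y$ denotes the subgraph of $G$ induced by $Y$, and $\overline{X}=V\setminus X$. For a node $v$ and $F\subseteq V\setminus\{v\}$, $reach_v(F)=\{u\in\overline{F}: u \text{ has a directed path to } v \text{ in } G_{\overline{F}}\}$ (so $v\in reach_v(F)$). *)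

theory Defs
  imports Complex_Main
begin

abbreviation nodes :: "nat \<Rightarrow> nat set" where
  "nodes n \<equiv> {1..n}"

definition reach :: "nat \<Rightarrow> (nat \<times> nat) set \<Rightarrow> nat \<Rightarrow> nat set \<Rightarrow> nat set" where
  "reach n E v F = {u \<in> nodes n - F. (u, v) \<in> (Restr E (nodes n - F))\<^sup>*}"

definition three_reach :: "nat \<Rightarrow> (nat \<times> nat) set \<Rightarrow> nat \<Rightarrow> bool" where
  "three_reach n E f \<longleftrightarrow>
     (\<forall>u \<in> nodes n. \<forall>v \<in> nodes n. \<forall>F Fu Fv.
        F \<subseteq> nodes n \<and> Fu \<subseteq> nodes n \<and> Fv \<subseteq> nodes n \<and>
        card F \<le> f \<and> card Fu \<le> f \<and> card Fv \<le> f \<and>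
        u \<notin> F \<union> Fu \<and> v \<notin> F \<union> Fv \<longrightarrow>
        reach n E v (F \<union> Fv) \<inter> reach n E u (F \<union> Fu) \<noteq> {})"

text \<open>Message contents: finite lists of reals (rich enough to encode numbers, node ids,
  paths, values, ...).\<close>
type_synonym msg = "real list"

text \<open>A delivery carries (sender, tag, content).  The tag (k, idx) identifies the message
  sent by a nonfaulty sender: it is the idx-th message sent by the sender when its local
  history reached length k.  Tags are bookkeeping only; algorithms never see them.\<close>
type_synonym delivery = "nat \<times> (nat \<times> nat) \<times> msg"

text \<open>A schedule: at global time t, node j receives at most one message.\<close>
type_synonym schedule = "nat \<Rightarrow> nat \<Rightarrow> delivery option"

text \<open>A deterministic algorithm: given node id, input and the local history of received
  (sender, content) pairs, it returns the messages (destination, content) sent at the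
  step in which the history became exactly this list (the empty history is the initial
  step), and possibly an out_val value.\<close>
type_synonym send_fn = "nat \<Rightarrow> real \<Rightarrow> (nat \<times> msg) list \<Rightarrow> (nat \<times> msg) list"
type_synonym dec_fn = "nat \<Rightarrow> real \<Rightarrow> (nat \<times> msg) list \<Rightarrow> real option"

definition hist :: "schedule \<Rightarrow> nat \<Rightarrow> nat \<Rightarrow> delivery list" where
  "hist e j t = map the (filter (\<lambda>d. d \<noteq> None) (map (\<lambda>s. e s j) [0..<t]))"

definition view :: "delivery list \<Rightarrow> (nat \<times> msg) list" where
  "view h = map (\<lambda>(s, g, m). (s, m)) h"

definition sent :: "send_fn \<Rightarrow> (nat \<Rightarrow> real) \<Rightarrow> schedule \<Rightarrow> nat \<Rightarrow> nat \<Rightarrow> nat \<Rightarrow> (nat \<times> msg) list" where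
  "sent alg x e i t k = alg i (x i) (view (take k (hist e i t)))"

text \<open>Admissible executions of the algorithm alg on graph (nodes n, E) with inputs x and
  faulty set T:
   (1) messages travel only along edges (or from a node to itself);
   (2) a message attributed to a nonfaulty sender was actually sent by it earlier;
   (3) no duplication of messages from nonfaulty senders;
   (4) reliability: every message sent by a nonfaulty node to a nonfaulty neighbour (or
       itself) is eventually delivered (finite but unbounded delay).
  Faulty nodes are unconstrained (Byzantine): their messages are arbitrary.\<close>
definition admissible ::
  "nat \<Rightarrow> (nat \<times> nat) set \<Rightarrow> send_fn \<Rightarrow> nat set \<Rightarrow> (nat \<Rightarrow> real) \<Rightarrow> schedule \<Rightarrow> bool" where
  "admissible n E alg T x e \<longleftrightarrow>
     (\<forall>t j i g m. e t j = Some (i, g, m) \<longrightarrow> i \<in> nodes n \<and> (i = j \<or> (i, j) \<in> E)) \<and>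
     (\<forall>t j i k idx m. e t j = Some (i, (k, idx), m) \<longrightarrow> i \<notin> T \<longrightarrow>
        k \<le> length (hist e i t) \<and> idx < length (sent alg x e i t k) \<and>
        sent alg x e i t k ! idx = (j, m)) \<and>
     (\<forall>t t' j j' i g m m'. e t j = Some (i, g, m) \<longrightarrow> e t' j' = Some (i, g, m') \<longrightarrow>
        i \<notin> T \<longrightarrow> t = t' \<and> j = j') \<and>
     (\<forall>i \<in> nodes n - T. \<forall>t k idx j m.
        k \<le> length (hist e i t) \<longrightarrow> idx < length (sent alg x e i t k) \<longrightarrow>
        sent alg x e i t k ! idx = (j, m) \<longrightarrow> j \<in> nodes n - T \<longrightarrow> (i = j \<or> (i, j) \<in> E) \<longrightarrow>
        (\<exists>t'. e t' j = Some (i, (k, idx), m)))"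

definition decided :: "dec_fn \<Rightarrow> (nat \<Rightarrow> real) \<Rightarrow> schedule \<Rightarrow> nat \<Rightarrow> nat \<Rightarrow> bool" where
  "decided dec x e i t \<longleftrightarrow> dec i (x i) (view (hist e i t)) \<noteq> None"

definition out_val :: "dec_fn \<Rightarrow> (nat \<Rightarrow> real) \<Rightarrow> schedule \<Rightarrow> nat \<Rightarrow> real" where
  "out_val dec x e i = the (dec i (x i) (view (hist e i (LEAST t. decided dec x e i t))))"

definition approx_consensus_possible :: "nat \<Rightarrow> (nat \<times> nat) set \<Rightarrow> nat \<Rightarrow> bool" where
  "approx_consensus_possible n E f \<longleftrightarrow>
     (\<forall>\<epsilon>::real. \<epsilon> > 0 \<longrightarrow>
       (\<exists>alg :: send_fn. \<exists>dec :: dec_fn.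
          \<forall>x T e. T \<subseteq> nodes n \<longrightarrow> card T \<le> f \<longrightarrow> admissible n E alg T x e \<longrightarrow>
            (\<forall>i \<in> nodes n - T. \<exists>t. decided dec x e i t) \<and>
            (\<forall>i \<in> nodes n - T. \<forall>j \<in> nodes n - T. \<bar>out_val dec x e i - out_val dec x e j\<bar> \<le> \<epsilon>) \<and>
            (\<forall>i \<in> nodes n - T. (\<exists>j \<in> nodes n - T. x j \<le> out_val dec x e i) \<and>
                                 (\<exists>j \<in> nodes n - T. out_val dec x e i \<le> x j))))"

end

theory Submission
  imports Defs "HOL-Analysis.Analysis"
begin

text \<open>Necessity is an indistinguishability argument.  If the sets reached by v outside F and Fv and by u
  outside F and Fu are disjoint, run the algorithm once with all inputs 0 and Fv crashed, once with
  all inputs 1 and Fu crashed, and once with F faulty, showing the first run to v and the second one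
  to u until both have decided, while messages from Fv and Fu are delayed.

  For sufficiency, inputs are moved to a bounded interval by arctan, so that halving the
  diameter in each round gives an a priori bound on the diameter at round r; a node outputs the tangent
  of its value once the tangent varies by at most \<epsilon> within that bound, and no knowledge of the input
  range is needed.  In a round, values are flooded along walks.  A node y reports a suspected set K
  and values val once it has received val z from z along all walks avoiding K.  A node v then waits
  for such reports along all walks avoiding a set F, and checks that the values that the reporters saw
  pass through nodes reaching them outside of F also arrive at v.  For each hypothetical fault set S
  it considers the values received along walks avoiding S, and takes the midpoint of the
  largest minimum L and the smallest maximum U.

  The choice of S as the actual fault set shows that L and U lie within the nonfaulty range.  The
  crucial inequality that L of v is at most U of u, for any nonfaulty v and u, uses the 3-reach
  condition several times: it gives a nonfaulty y whose report both v and u have received, then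
  nodes q for v and q' for u through which they learn about what y reports, and finally a common z
  reaching q outside of K and S, and q' outside of K and S', whose reported value is
  considered by v under S and by u under S'.\<close>

subsection \<open>Histories and schedules\<close>

lemma hist_0 [simp]: "hist e j 0 = []"
  by (simp add: hist_def)

lemma hist_Suc: "hist e j (Suc t) = hist e j t @ (case e t j of None \<Rightarrow> [] | Some d \<Rightarrow> [d])"
  by (auto simp: hist_def split: option.splits)

lemma in_set_hist_iff: "d \<in> set (hist e j t) \<longleftrightarrow> (\<exists>s<t. e s j = Some d)"
proof (induction t)
  case (Suc t)
  thus ?case by (cases "e t j") (auto simp: hist_Suc less_Suc_eq)
qed simp

lemma hist_cong: "(\<And>s. s < t \<Longrightarrow> e s j = e' s j) \<Longrightarrow> hist e j t = hist e' j t"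
  by (induction t) (auto simp: hist_Suc)

lemma hist_prefix: "t \<le> t' \<Longrightarrow> \<exists>d. hist e j t' = hist e j t @ d"
  by (induction t' rule: dec_induct) (auto simp: hist_Suc)

lemma take_hist: "t \<le> t' \<Longrightarrow> k \<le> length (hist e j t) \<Longrightarrow> take k (hist e j t') = take k (hist e j t)"
  using hist_prefix[of t t' e j] by auto

lemma length_hist_mono: "t \<le> t' \<Longrightarrow> length (hist e j t) \<le> length (hist e j t')"
  using hist_prefix[of t t' e j] by auto

lemma sent_mono:
  "t \<le> t' \<Longrightarrow> k \<le> length (hist e i t) \<Longrightarrow> sent alg x e i t' k = sent alg x e i t k"
  by (simp add: sent_def take_hist)

lemma sent_cong: "hist e i t = hist e' i t \<Longrightarrow> sent alg x e i t k = sent alg x e' i t k"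
  by (simp add: sent_def)

lemma admissible_edge:
  assumes "admissible n E alg T x e" "e t j = Some (i, g, m)"
  shows "i \<in> nodes n \<and> (i = j \<or> (i, j) \<in> E)"
  using assms(1)[unfolded admissible_def, THEN conjunct1] assms(2) by blast

lemma admissible_authentic:
  assumes "admissible n E alg T x e" "e t j = Some (i, (k, idx), m)" "i \<notin> T"
  shows "k \<le> length (hist e i t) \<and> idx < length (sent alg x e i t k) \<and>
    sent alg x e i t k ! idx = (j, m)"
  using assms(1)[unfolded admissible_def, THEN conjunct2, THEN conjunct1] assms(2,3) by blast

lemma admissible_unique:
  assumes "admissible n E alg T x e" "e t j = Some (i, g, m)" "e t' j' = Some (i, g, m')" "i \<notin> T"
  shows "t = t' \<and> j = j'"
  using assms(1)[unfolded admissible_def, THEN conjunct2, THEN conjunct2, THEN conjunct1] assms(2-4)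
  by blast

lemma admissible_delivers:
  assumes "admissible n E alg T x e" "i \<in> nodes n - T" "k \<le> length (hist e i t)"
    "(j, m) \<in> set (sent alg x e i t k)" "j \<in> nodes n - T" "i = j \<or> (i, j) \<in> E"
  shows "\<exists>t' g. e t' j = Some (i, g, m)"
proof -
  obtain idx where "idx < length (sent alg x e i t k)" "sent alg x e i t k ! idx = (j, m)"
    using assms(4) by (auto simp: in_set_conv_nth)
  with assms(1)[unfolded admissible_def, THEN conjunct2, THEN conjunct2, THEN conjunct2] assms(2,3,5,6)
  show ?thesis by blast
qed

subsection \<open>Fair extensions of finite schedules\<close>

text \<open>The safety half of \<open>admissible\<close>, restricted to times before
  \<open>t0\<close>. Reliability is a liveness condition and is left to the extension.\<close>

definition safe_upto ::
  "nat \<Rightarrow> (nat \<times> nat) set \<Rightarrow> send_fn \<Rightarrow> nat set \<Rightarrow> (nat \<Rightarrow> real) \<Rightarrow> nat \<Rightarrow> schedule \<Rightarrow> bool" where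
  "safe_upto n E alg T x t0 e \<longleftrightarrow>
     (\<forall>t<t0. \<forall>j i g m. e t j = Some (i, g, m) \<longrightarrow> i \<in> nodes n \<and> (i = j \<or> (i, j) \<in> E)) \<and>
     (\<forall>t<t0. \<forall>j i k idx m. e t j = Some (i, (k, idx), m) \<longrightarrow> i \<notin> T \<longrightarrow>
        k \<le> length (hist e i t) \<and> idx < length (sent alg x e i t k) \<and>
        sent alg x e i t k ! idx = (j, m)) \<and>
     (\<forall>t<t0. \<forall>t'<t0. \<forall>j j' i g m m'. e t j = Some (i, g, m) \<longrightarrow> e t' j' = Some (i, g, m') \<longrightarrow>
        i \<notin> T \<longrightarrow> t = t' \<and> j = j')"

context
  fixes n :: nat and E :: "(nat \<times> nat) set" and alg :: send_fn and T :: "nat set"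
    and x :: "nat \<Rightarrow> real" and t0 :: nat and p :: schedule
begin

text \<open>The scheduler serves one tag per time step. The discarded component of the outer pair
  makes every tag come up at arbitrarily late times, which gives fairness.\<close>

definition tag_at :: "nat \<Rightarrow> nat \<times> nat \<times> nat" where
  "tag_at t = (let (i, c) = prod_decode (fst (prod_decode t)) in (i, prod_decode c))"

lemma tag_at_recurs: "\<exists>t'\<ge>t. tag_at t' = (i, k, idx)"
proof -
  let ?t' = "prod_encode (prod_encode (i, prod_encode (k, idx)), t)"
  have "tag_at ?t' = (i, k, idx)" by (simp add: tag_at_def)
  moreover have "?t' \<ge> t" by (simp add: le_prod_encode_2)
  ultimately show ?thesis by blast
qed

definition deliverable :: "schedule \<Rightarrow> nat \<Rightarrow> nat \<Rightarrow> nat \<Rightarrow> nat \<Rightarrow> nat \<Rightarrow> msg \<Rightarrow> bool" where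
  "deliverable e t i k idx j m \<longleftrightarrow>
     i \<in> nodes n - T \<and> k \<le> length (hist e i t) \<and> idx < length (sent alg x e i t k) \<and>
     sent alg x e i t k ! idx = (j, m) \<and> (i = j \<or> (i, j) \<in> E) \<and>
     (\<forall>s<t. \<forall>j' m'. e s j' \<noteq> Some (i, (k, idx), m'))"

definition sched_step :: "schedule \<Rightarrow> nat \<Rightarrow> nat \<Rightarrow> delivery option" where
  "sched_step e t j =
     (let (i, k, idx) = tag_at t; m = snd (sent alg x e i t k ! idx) in
      if deliverable e t i k idx j m then Some (i, (k, idx), m) else None)"

primrec sched_prefix :: "nat \<Rightarrow> schedule" where
  "sched_prefix 0 = (\<lambda>_ _. None)"
| "sched_prefix (Suc t) =
     (sched_prefix t)(t := if t < t0 then p t else sched_step (sched_prefix t) t)"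

definition sched :: schedule where
  "sched t = sched_prefix (Suc t) t"

lemma sched_prefix_eq: "s < t \<Longrightarrow> sched_prefix t s = sched s"
  by (induction t) (auto simp: sched_def less_Suc_eq)

lemma sched_step_cong:
  assumes "\<And>s. s < t \<Longrightarrow> e s = e' s"
  shows "sched_step e t = sched_step e' t"
proof -
  have h: "hist e i t = hist e' i t" for i
    by (rule hist_cong) (simp add: assms)
  have "deliverable e t = deliverable e' t"
    by (intro ext) (simp add: deliverable_def h sent_cong[OF h] assms cong: conj_cong)
  thus ?thesis
    by (intro ext) (simp add: sched_step_def sent_cong[OF h])
qed

lemma sched_before: "t < t0 \<Longrightarrow> sched t = p t"
  by (simp add: sched_def)

lemma sched_after: "t0 \<le> t \<Longrightarrow> sched t = sched_step sched t"
  by (simp add: sched_def) (rule sched_step_cong, simp add: sched_prefix_eq sched_def)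

lemma sched_after_Some:
  assumes "t0 \<le> t" "sched t j = Some (i, (k, idx), m)"
  shows "deliverable sched t i k idx j m"
  using assms by (auto simp: sched_after sched_step_def Let_def split: prod.splits if_splits)

lemma sched_admissible:
  assumes "safe_upto n E alg T x t0 p"
  shows "admissible n E alg T x sched"
proof -
  have hist_eq: "hist sched i t = hist p i t" if "t \<le> t0" for i t
    by (rule hist_cong) (use that in \<open>simp add: sched_before\<close>)
  have c1: "i \<in> nodes n \<and> (i = j \<or> (i, j) \<in> E)" if "sched t j = Some (i, g, m)" for t j i g m
  proof (cases "t < t0")
    case True
    thus ?thesis using assms that unfolding safe_upto_def by (metis sched_before)
  next
    case False
    thus ?thesis using sched_after_Some[of t j i "fst g" "snd g" m] that
      by (auto simp: deliverable_def)
  qed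
  have c2: "k \<le> length (hist sched i t) \<and> idx < length (sent alg x sched i t k) \<and>
        sent alg x sched i t k ! idx = (j, m)"
    if "sched t j = Some (i, (k, idx), m)" "i \<notin> T" for t j i k idx m
  proof (cases "t < t0")
    case True
    hence "p t j = Some (i, (k, idx), m)" using that by (simp add: sched_before)
    with assms True that(2) have "k \<le> length (hist p i t) \<and> idx < length (sent alg x p i t k) \<and>
        sent alg x p i t k ! idx = (j, m)" unfolding safe_upto_def by blast
    thus ?thesis using True by (simp add: hist_eq sent_cong[of sched i t p])
  next
    case False
    thus ?thesis using sched_after_Some that by (auto simp: deliverable_def)
  qed
  have c3: "t = t' \<and> j = j'"
    if *: "sched t j = Some (i, g, m)" "sched t' j' = Some (i, g, m')" "i \<notin> T" for t t' j j' i g m m'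
  proof -
    \<comment> \<open>Before \<open>t0\<close> uniqueness is inherited from \<open>p\<close>; from
      \<open>t0\<close> on, \<open>deliverable\<close> refuses every tag that has occurred
      earlier.\<close>
    have less: False if "s < s'" "sched s l = Some (i, g, a)" "sched s' l' = Some (i, g, a')"
      for s s' l l' a a'
    proof (cases "s' < t0")
      case True
      hence "p s l = Some (i, g, a)" "p s' l' = Some (i, g, a')" "s < t0"
        using that by (auto simp: sched_before)
      thus False using assms True \<open>i \<notin> T\<close> \<open>s < s'\<close> unfolding safe_upto_def by (metis nat_neq_iff)
    next
      case False
      thus False using sched_after_Some[of s' l' i "fst g" "snd g" a'] that
        by (auto simp: deliverable_def)
    qed
    have "t = t'" using less * by (meson linorder_neqE_nat)
    moreover have "j = j'"
    proof -
      have "(j, m) = (j', m')"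
        using c2[of t j i "fst g" "snd g" m] c2[of t' j' i "fst g" "snd g" m'] * \<open>t = t'\<close> by auto
      thus ?thesis by simp
    qed
    ultimately show ?thesis by simp
  qed
  have c4: "\<exists>t'. sched t' j = Some (i, (k, idx), m)"
    if i: "i \<in> nodes n - T" and k: "k \<le> length (hist sched i t)"
      and idx: "idx < length (sent alg x sched i t k)" "sent alg x sched i t k ! idx = (j, m)"
      and ij: "i = j \<or> (i, j) \<in> E" for i t k idx j m
  proof -
    \<comment> \<open>At \<open>s\<close> the tag is served. Either it was delivered before, and
      authenticity shows that receiver and content were the right ones, or it is delivered
      now.\<close>
    obtain s where s: "s \<ge> max t t0" "tag_at s = (i, k, idx)" using tag_at_recurs by blast
    have st: "sent alg x sched i s k = sent alg x sched i t k"
      using s k by (intro sent_mono) auto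
    have ks: "k \<le> length (hist sched i s)" using k length_hist_mono[of t s sched i] s by auto
    show ?thesis
    proof (cases "\<exists>s'<s. \<exists>j' m'. sched s' j' = Some (i, (k, idx), m')")
      case True
      then obtain s' j' m' where s': "sched s' j' = Some (i, (k, idx), m')" "s' < s" by blast
      with i have "k \<le> length (hist sched i s') \<and> sent alg x sched i s' k ! idx = (j', m')"
        using c2[OF s'(1)] by blast
      moreover from this have "sent alg x sched i s k = sent alg x sched i s' k"
        using s' by (intro sent_mono) auto
      ultimately have "j' = j" "m' = m" using idx st by auto
      thus ?thesis using s' by blast
    next
      case False
      hence "deliverable sched s i k idx j m"
        using i idx ij ks st by (auto simp: deliverable_def)
      hence "sched_step sched s j = Some (i, (k, idx), m)"
        using s st idx by (simp add: sched_step_def)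
      thus ?thesis using s sched_after by (metis max.bounded_iff)
    qed
  qed
  show ?thesis unfolding admissible_def
    apply (intro conjI)
       apply (use c1 in blast)
      apply (use c2 in blast)
     apply (use c3 in blast)
    apply (intro allI ballI impI)
    apply (rule c4, assumption+)
    done
qed

end

text \<open>Faulty nodes are silent from \<open>t0\<close> on, so \<open>t0 = 0\<close> yields runs
  in which they have crashed from the start.\<close>

lemma fair_extension:
  assumes "safe_upto n E alg T x t0 p"
  obtains e where "admissible n E alg T x e" "\<And>t. t < t0 \<Longrightarrow> e t = p t"
    "\<And>t j i g m. t0 \<le> t \<Longrightarrow> e t j = Some (i, g, m) \<Longrightarrow> i \<notin> T"
proof
  let ?e = "sched n E alg T x t0 p"
  show "admissible n E alg T x ?e" using assms by (rule sched_admissible)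
  show "?e t = p t" if "t < t0" for t using that by (rule sched_before)
  show "i \<notin> T" if "t0 \<le> t" "?e t j = Some (i, g, m)" for t j i g m
    using sched_after_Some[of t0 t n E alg T x p j i "fst g" "snd g" m] that
    by (auto simp: deliverable_def)
qed

subsection \<open>Necessity\<close>

lemma reach_closed:
  assumes "j \<in> reach n E v F" "(i, j) \<in> E" "i \<in> nodes n" "i \<notin> F"
  shows "i \<in> reach n E v F"
  using assms by (auto simp: reach_def intro: converse_rtrancl_into_rtrancl)

lemma reach_refl: "v \<in> nodes n \<Longrightarrow> v \<notin> F \<Longrightarrow> v \<in> reach n E v F"
  by (simp add: reach_def)

text \<open>Indistinguishability: \<open>out_val\<close> refers to the first decision, so what
  happens after \<open>t0\<close> is irrelevant.\<close>

lemma decided_cong: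
  assumes "\<And>t. t \<le> t0 \<Longrightarrow> hist e v t = hist e' v t" "x v = x' v" "decided dec x e v t0"
  shows "out_val dec x e v = out_val dec x' e' v"
proof -
  have iff: "decided dec x e v t \<longleftrightarrow> decided dec x' e' v t" if "t \<le> t0" for t
    using assms(1)[OF that] assms(2) by (simp add: decided_def)
  let ?L = "LEAST t. decided dec x e v t"
  have L: "?L \<le> t0" "decided dec x e v ?L" using assms(3) by (auto intro: Least_le LeastI)
  have "(LEAST t. decided dec x' e' v t) = ?L"
  proof (rule Least_equality)
    show "decided dec x' e' v ?L" using iff L by blast
    show "?L \<le> t" if "decided dec x' e' v t" for t
      using iff[of t] that L(1) Least_le[of "decided dec x e v" t] by (cases "t \<le> t0") auto
  qed
  thus ?thesis using assms(1)[OF L(1)] assms(2) by (simp add: out_val_def)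
qed

lemma consensus_imp_three_reach:
  assumes "approx_consensus_possible n E f"
  shows "three_reach n E f"
proof (rule ccontr)
  assume "\<not> three_reach n E f"
  then obtain u v F Fu Fv where uv: "u \<in> nodes n" "v \<in> nodes n"
    and sub: "F \<subseteq> nodes n" "Fu \<subseteq> nodes n" "Fv \<subseteq> nodes n"
    and card: "card F \<le> f" "card Fu \<le> f" "card Fv \<le> f"
    and nin: "u \<notin> F \<union> Fu" "v \<notin> F \<union> Fv"
    and disj: "reach n E v (F \<union> Fv) \<inter> reach n E u (F \<union> Fu) = {}"
    unfolding three_reach_def by blast
  define A where "A = reach n E v (F \<union> Fv)"
  define B where "B = reach n E u (F \<union> Fu)"
  have "(1/2::real) > 0" by simp
  with assms obtain alg dec where "\<forall>x T e. T \<subseteq> nodes n \<longrightarrow> card T \<le> f \<longrightarrow>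
      admissible n E alg T x e \<longrightarrow>
      (\<forall>i \<in> nodes n - T. \<exists>t. decided dec x e i t) \<and>
      (\<forall>i \<in> nodes n - T. \<forall>j \<in> nodes n - T. \<bar>out_val dec x e i - out_val dec x e j\<bar> \<le> 1/2) \<and>
      (\<forall>i \<in> nodes n - T. (\<exists>j \<in> nodes n - T. x j \<le> out_val dec x e i) \<and>
                           (\<exists>j \<in> nodes n - T. out_val dec x e i \<le> x j))"
    unfolding approx_consensus_possible_def
    by (elim allE[of _ "1/2"] impE exE) (assumption, rule that, assumption)
  note cons = this[THEN spec, THEN spec, THEN spec, THEN mp, THEN mp, THEN mp]
  \<comment> \<open>\<open>Z\<close> crashes and all inputs equal \<open>c\<close>, so validity pins
    the output to \<open>c\<close>.\<close>
  have silent: "\<exists>e t. admissible n E alg Z (\<lambda>_. c) e \<and> (\<forall>t j i g m. e t j = Some (i, g, m) \<longrightarrow> i \<notin> Z)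
      \<and> decided dec (\<lambda>_. c) e w t \<and> out_val dec (\<lambda>_. c) e w = c"
    if "Z \<subseteq> nodes n" "card Z \<le> f" "w \<in> nodes n - Z" for Z c w
  proof -
    obtain e where e: "admissible n E alg Z (\<lambda>_. c) e"
        "\<And>t j i g m. e t j = Some (i, g, m) \<Longrightarrow> i \<notin> Z"
      using fair_extension[of n E alg Z "\<lambda>_. c" 0 "\<lambda>_ _. None"]
      by (auto simp: safe_upto_def)
    from cons[OF that(1,2) e(1)] that(3) have "\<exists>t. decided dec (\<lambda>_. c) e w t"
      "out_val dec (\<lambda>_. c) e w \<le> c" "c \<le> out_val dec (\<lambda>_. c) e w" by blast+
    with e show ?thesis by (metis order_antisym)
  qed
  obtain e1 t1 where e1: "admissible n E alg Fv (\<lambda>_. 0) e1"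
      "\<And>t j i g m. e1 t j = Some (i, g, m) \<Longrightarrow> i \<notin> Fv"
      "decided dec (\<lambda>_. 0) e1 v t1" "out_val dec (\<lambda>_. 0) e1 v = 0"
    using silent[OF sub(3) card(3), of v 0] uv nin by blast
  obtain e2 t2 where e2: "admissible n E alg Fu (\<lambda>_. 1) e2"
      "\<And>t j i g m. e2 t j = Some (i, g, m) \<Longrightarrow> i \<notin> Fu"
      "decided dec (\<lambda>_. 1) e2 u t2" "out_val dec (\<lambda>_. 1) e2 u = 1"
    using silent[OF sub(2) card(2), of u 1] uv nin by blast
  define t0 where "t0 = max t1 t2"
  \<comment> \<open>Nodes of \<open>A\<close> see the run \<open>e1\<close>, nodes of
    \<open>B\<close> see \<open>e2\<close>, and everything addressed to other nodes is held back
    until \<open>t0\<close>. The nodes of \<open>F\<close> thus show two faces.\<close>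
  define p where "p = (\<lambda>t j. if j \<in> A then e1 t j else if j \<in> B then e2 t j else None)"
  define x where "x = (\<lambda>i. if i \<in> B then 1 else 0 :: real)"
  have AB: "A \<inter> B = {}" using disj by (simp add: A_def B_def)
  have histA: "hist p i t = hist e1 i t" if "i \<in> A" for i t
    by (rule hist_cong) (use that in \<open>simp add: p_def\<close>)
  have histB: "hist p i t = hist e2 i t" if "i \<in> B" for i t
    by (rule hist_cong) (use that AB in \<open>auto simp: p_def\<close>)
  have adm1: "i \<in> nodes n \<and> (i = j \<or> (i, j) \<in> E)"
      "i \<notin> Fv \<Longrightarrow> k \<le> length (hist e1 i t) \<and> idx < length (sent alg (\<lambda>_. 0) e1 i t k) \<and>
        sent alg (\<lambda>_. 0) e1 i t k ! idx = (j, m)"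
      if "e1 t j = Some (i, (k, idx), m)" for t j i k idx m
    using admissible_edge[OF e1(1) that] admissible_authentic[OF e1(1) that] by blast+
  have adm2: "i \<in> nodes n \<and> (i = j \<or> (i, j) \<in> E)"
      "i \<notin> Fu \<Longrightarrow> k \<le> length (hist e2 i t) \<and> idx < length (sent alg (\<lambda>_. 1) e2 i t k) \<and>
        sent alg (\<lambda>_. 1) e2 i t k ! idx = (j, m)"
      if "e2 t j = Some (i, (k, idx), m)" for t j i k idx m
    using admissible_edge[OF e2(1) that] admissible_authentic[OF e2(1) that] by blast+
  \<comment> \<open>In \<open>e1\<close> no sender is in \<open>Fv\<close>. A sender to
    \<open>A\<close> that is also outside \<open>F\<close> lies in \<open>A\<close> by closure of
    \<open>reach\<close>, so it has the same input and history in \<open>p\<close> as in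
    \<open>e1\<close>.\<close>
  have inA: "i \<in> A" if "j \<in> A" "e1 t j = Some (i, g, m)" "i \<notin> F" for t j i g m
    using adm1(1)[of t j i "fst g" "snd g" m] that e1(2)[OF that(2)] reach_closed[of j n E v "F \<union> Fv" i]
    by (auto simp: A_def)
  have inB: "i \<in> B" if "j \<in> B" "e2 t j = Some (i, g, m)" "i \<notin> F" for t j i g m
    using adm2(1)[of t j i "fst g" "snd g" m] that e2(2)[OF that(2)] reach_closed[of j n E u "F \<union> Fu" i]
    by (auto simp: B_def)
  have p_cases: "(j \<in> A \<and> e1 t j = Some d) \<or> (j \<in> B \<and> e2 t j = Some d)" if "p t j = Some d" for t j d
    using that by (auto simp: p_def split: if_splits)
  have safe: "safe_upto n E alg F x t0 p"
    unfolding safe_upto_def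
  proof (intro conjI allI impI)
    fix t j i g m assume "p t j = Some (i, g, m)"
    from p_cases[OF this] show "i \<in> nodes n" "i = j \<or> (i, j) \<in> E"
      using adm1(1)[of t j i "fst g" "snd g" m] adm2(1)[of t j i "fst g" "snd g" m] by auto
  next
    fix t j i k idx m assume pt: "p t j = Some (i, (k, idx), m)" and "i \<notin> F"
    have "k \<le> length (hist p i t) \<and> idx < length (sent alg x p i t k) \<and>
        sent alg x p i t k ! idx = (j, m)"
      using p_cases[OF pt]
    proof (elim disjE conjE)
      assume *: "j \<in> A" "e1 t j = Some (i, (k, idx), m)"
      hence "i \<in> A" using inA \<open>i \<notin> F\<close> by blast
      moreover from this have "x i = 0" using AB by (auto simp: x_def)
      ultimately show ?thesis using adm1(2)[OF *(2)] e1(2)[OF *(2)] by (simp add: sent_def histA)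
    next
      assume *: "j \<in> B" "e2 t j = Some (i, (k, idx), m)"
      hence "i \<in> B" using inB \<open>i \<notin> F\<close> by blast
      moreover from this have "x i = 1" by (auto simp: x_def)
      ultimately show ?thesis using adm2(2)[OF *(2)] e2(2)[OF *(2)] by (simp add: sent_def histB)
    qed
    thus "k \<le> length (hist p i t)" "idx < length (sent alg x p i t k)"
      "sent alg x p i t k ! idx = (j, m)" by auto
  next
    fix t t' j j' i g m m'
    assume *: "p t j = Some (i, g, m)" "p t' j' = Some (i, g, m')" "i \<notin> F"
    \<comment> \<open>A nonfaulty sender lies in only one of the disjoint sets \<open>A\<close> and
      \<open>B\<close>, so both deliveries stem from the same run.\<close>
    have "(e1 t j = Some (i, g, m) \<and> e1 t' j' = Some (i, g, m')) \<or>
          (e2 t j = Some (i, g, m) \<and> e2 t' j' = Some (i, g, m'))"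
      using p_cases[OF *(1)] p_cases[OF *(2)] inA inB \<open>i \<notin> F\<close> AB by blast
    hence "t = t' \<and> j = j'"
    proof
      assume "e1 t j = Some (i, g, m) \<and> e1 t' j' = Some (i, g, m')"
      with admissible_unique[OF e1(1)] e1(2) show ?thesis by blast
    next
      assume "e2 t j = Some (i, g, m) \<and> e2 t' j' = Some (i, g, m')"
      with admissible_unique[OF e2(1)] e2(2) show ?thesis by blast
    qed
    thus "t = t'" "j = j'" by auto
  qed
  then obtain e where e: "admissible n E alg F x e" "\<And>t. t < t0 \<Longrightarrow> e t = p t"
    by (rule fair_extension) (rule that)
  have vA: "v \<in> A" and uB: "u \<in> B" using uv nin by (auto simp: A_def B_def intro: reach_refl)
  have "hist e1 v t = hist e v t" if "t \<le> t0" for t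
    by (rule hist_cong) (use that vA e(2) in \<open>simp add: p_def\<close>)
  hence "out_val dec (\<lambda>_. 0) e1 v = out_val dec x e v"
    using e1(3) vA AB by (intro decided_cong[of t1]) (auto simp: t0_def x_def)
  moreover have "hist e2 u t = hist e u t" if "t \<le> t0" for t
    by (rule hist_cong) (use that uB AB e(2) in \<open>auto simp: p_def\<close>)
  hence "out_val dec (\<lambda>_. 1) e2 u = out_val dec x e u"
    using e2(3) uB by (intro decided_cong[of t2]) (auto simp: t0_def x_def)
  ultimately have "\<bar>out_val dec x e u - out_val dec x e v\<bar> = 1" using e1(4) e2(4) by simp
  moreover have "\<bar>out_val dec x e u - out_val dec x e v\<bar> \<le> 1/2"
    using cons[OF sub(1) card(1) e(1)] uv nin by blast
  ultimately show False by simp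
qed

subsection \<open>Tokens and reports\<close>

text \<open>A token (m, w, p) carries the item m with payload p along the walk w, which starts at the
  originator and ends at the holder.  Item 2 * r of a node is its value in round r, item 2 * r + 1 is
  its report on the values of round r.\<close>

type_synonym token = "nat \<times> nat list \<times> real list"

text \<open>The length entry separates the walk from the payload, so decoding is
  unambiguous.\<close>

definition enc :: "token \<Rightarrow> msg" where
  "enc = (\<lambda>(m, w, p). real m # real (length w) # map real w @ p)"

lemma inj_enc: "inj enc"
  by (auto simp: inj_def enc_def inj_map_eq_map inj_on_def)

lemma enc_eq_iff [simp]: "enc a = enc b \<longleftrightarrow> a = b"
  by (rule inj_eq[OF inj_enc])

text \<open>A report lists the indicator function of the suspects (entries 0 to n) followed by the
  reported values (entries n + 1 to 2 * n + 1); the entries for the non-node 0 are dummies.\<close>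

definition suspects :: "nat \<Rightarrow> real list \<Rightarrow> nat set" where
  "suspects n p = {i \<in> nodes n. p ! i = 1}"

definition reported :: "nat \<Rightarrow> real list \<Rightarrow> nat \<Rightarrow> real" where
  "reported n p z = p ! (Suc n + z)"

lemma report_exists:
  assumes "K \<subseteq> nodes n"
  obtains p where "suspects n p = K" "\<And>z. z \<in> nodes n \<Longrightarrow> reported n p z = g z"
proof
  let ?p = "map (\<lambda>i. if i \<in> K then 1 else 0) [0..<Suc n] @ map g [0..<Suc n]"
  show "suspects n ?p = K"
    using assms by (auto simp: suspects_def nth_append simp del: upt_Suc split: if_splits)
  show "reported n ?p z = g z" if "z \<in> nodes n" for z
    using that by (simp add: reported_def nth_append del: upt_Suc)
qed

section \<open>Walks of a fixed length\<close>

locale network =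
  fixes n f :: nat and E :: "(nat \<times> nat) set"
  assumes E_sub: "E \<subseteq> nodes n \<times> nodes n"
    and reach3: "three_reach n E f"
begin

text \<open>A walk may stay at a node, so that all walks can be given the same number of hops.\<close>

definition link :: "nat \<Rightarrow> nat \<Rightarrow> bool" where
  "link a b \<longleftrightarrow> a = b \<or> (a, b) \<in> E"

text \<open>\<open>card E\<close> steps suffice for reachability; one more keeps \<open>hops\<close>
  positive, so that every element of \<open>walks\<close> has at least one hop.\<close>

definition hops :: nat where
  "hops = Suc (card E)"

lemma finite_E: "finite E"
  using E_sub finite_subset by blast

lemma relpow_walk:
  assumes "(u, v) \<in> (Restr E X) ^^ k" "u \<in> X"
  shows "\<exists>w. length w = Suc k \<and> hd w = u \<and> last w = v \<and> set w \<subseteq> X \<and> successively link w"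
  using assms
proof (induction k arbitrary: v)
  case 0
  thus ?case by (intro exI[of _ "[u]"]) auto
next
  case (Suc k)
  then obtain v' where v': "(u, v') \<in> (Restr E X) ^^ k" "(v', v) \<in> Restr E X" by auto
  with Suc obtain w where w: "length w = Suc k \<and> hd w = u \<and> last w = v' \<and> set w \<subseteq> X \<and> successively link w"
    by blast
  with v' show ?case
    by (intro exI[of _ "w @ [v]"]) (auto simp: successively_append_iff link_def hd_append)
qed

lemma successively_replicate: "successively link (replicate k v)"
  by (simp add: successively_conv_nth link_def)

lemma reach_walk:
  assumes "u \<in> reach n E v F"
  obtains w where "length w = Suc hops" "hd w = u" "last w = v" "set w \<subseteq> nodes n - F"
    "successively link w"
proof -
  let ?X = "nodes n - F"
  have u: "u \<in> ?X" "(u, v) \<in> (Restr E ?X)\<^sup>*" using assms by (auto simp: reach_def)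
  have fin: "finite (Restr E ?X)" using finite_E by auto
  then obtain k where k: "k \<le> card (Restr E ?X)" "(u, v) \<in> (Restr E ?X) ^^ k"
    using u(2) rtrancl_finite_eq_relpow by blast
  have "card (Restr E ?X) \<le> hops" unfolding hops_def using finite_E by (intro le_SucI card_mono) auto
  hence kh: "k \<le> hops" using k by simp
  from relpow_walk[OF k(2) u(1)] obtain w where
    w: "length w = Suc k" "hd w = u" "last w = v" "set w \<subseteq> ?X" "successively link w" by blast
  let ?w = "w @ replicate (hops - k) v"
  have ne: "w \<noteq> []" using w by auto
  have "v \<in> ?X" using w(3,4) ne by (metis last_in_set subsetD)
  hence "set ?w \<subseteq> ?X" using w(4) by auto
  moreover have "last ?w = v" using w(3) by (auto simp: last_append)
  moreover have "successively link ?w"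
    using w(3,5) successively_replicate by (auto simp: successively_append_iff link_def)
  ultimately show thesis using that[of ?w] w kh ne by auto
qed

text \<open>There is room for two walks of \<open>hops\<close> hops glued at a node, which then sits
  at index \<open>hops\<close>.\<close>

definition walks :: "nat set \<Rightarrow> nat \<Rightarrow> nat list set" where
  "walks X v = {w. length w = Suc (2 * hops) \<and> successively link w \<and> set w \<subseteq> X \<and> last w = v}"

lemma walks_mono: "X \<subseteq> Y \<Longrightarrow> walks X v \<subseteq> walks Y v"
  by (auto simp: walks_def)

lemma finite_walks: "finite X \<Longrightarrow> finite (walks X v)"
  by (rule finite_subset[OF _ finite_lists_length_eq[of X "Suc (2 * hops)"]]) (auto simp: walks_def)

lemma walks_refl: "v \<in> X \<Longrightarrow> replicate (Suc (2 * hops)) v \<in> walks X v"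
  using successively_replicate[of "Suc (2 * hops)" v]
  by (auto simp: walks_def simp del: replicate_Suc)

lemma glue_walks:
  assumes P: "length P = Suc hops" "successively link P" "last P = q"
    and Q: "length Q = Suc hops" "successively link Q" "hd Q = q"
  shows "length (P @ tl Q) = Suc (2 * hops)" "successively link (P @ tl Q)"
    "hd (P @ tl Q) = hd P" "last (P @ tl Q) = last Q" "set (P @ tl Q) = set P \<union> set Q"
    "take (Suc hops) (P @ tl Q) = P" "drop hops (P @ tl Q) = Q" "(P @ tl Q) ! hops = q"
proof -
  obtain Q' where Q': "Q = q # Q'" using Q by (cases Q) auto
  obtain P' where P': "P = P' @ [q]" using P by (cases P rule: rev_cases) auto
  show "length (P @ tl Q) = Suc (2 * hops)" "hd (P @ tl Q) = hd P"
    "last (P @ tl Q) = last Q" "set (P @ tl Q) = set P \<union> set Q"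
    "take (Suc hops) (P @ tl Q) = P" "drop hops (P @ tl Q) = Q" "(P @ tl Q) ! hops = q"
    using P Q by (auto simp: P' Q' hd_append nth_append)
  show "successively link (P @ tl Q)"
    using P(2) Q(2) by (auto simp: P' Q' successively_append_iff successively_Cons)
qed

text \<open>The receiver itself appends its name, and the sender must be the last node of the
  claimed walk. Hence a token of false provenance has a faulty node on its walk.\<close>

definition received :: "nat \<Rightarrow> (nat \<times> msg) list \<Rightarrow> token set" where
  "received v h = (\<lambda>(m, w, p). (m, w @ [v], p)) ` {(m, w, p). w \<noteq> [] \<and> (last w, enc (m, w, p)) \<in> set h}"

lemma in_received:
  "(m, w', p) \<in> received v h \<longleftrightarrow> (\<exists>w. w' = w @ [v] \<and> w \<noteq> [] \<and> (last w, enc (m, w, p)) \<in> set h)"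
  by (auto simp: received_def image_iff)

lemma finite_received: "finite (received v h)"
proof -
  have "{(m, w, p). w \<noteq> [] \<and> (last w, enc (m, w, p)) \<in> set h} \<subseteq> enc -` (snd ` set h)"
    by force
  moreover have "finite (enc -` (snd ` set h))" by (intro finite_vimageI inj_enc) auto
  ultimately show ?thesis unfolding received_def by (meson finite_imageI finite_subset)
qed

lemma received_mono: "set h \<subseteq> set h' \<Longrightarrow> received v h \<subseteq> received v h'"
  unfolding received_def by (intro image_mono) (blast dest: subsetD)

text \<open>Both waiting conditions below can always be met with the set of actual faults as the set of
  suspects, so no nonfaulty node blocks.\<close>

definition witness :: "nat \<Rightarrow> nat \<Rightarrow> token set \<Rightarrow> real list \<Rightarrow> bool" where
  "witness m v K p \<longleftrightarrow> card (suspects n p) \<le> f \<and> v \<notin> suspects n p \<and>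
     (\<forall>w \<in> walks (nodes n - suspects n p) v. (m, w, [reported n p (hd w)]) \<in> K)"

text \<open>Besides the reports along walks avoiding F, the node v waits for every token that a reporter
  hd w must have seen pass through a node w' ! hops from which it is reachable outside of F: if F
  contains all faults, then these tokens are bound to arrive at v as well.\<close>

definition verified :: "nat \<Rightarrow> nat \<Rightarrow> token set \<Rightarrow> nat set \<Rightarrow> (nat \<Rightarrow> real list) \<Rightarrow> bool" where
  "verified m v K F rep \<longleftrightarrow> F \<subseteq> nodes n \<and> card F \<le> f \<and> v \<notin> F \<and>
     (\<forall>w \<in> walks (nodes n - F) v. (Suc m, w, rep (hd w)) \<in> K \<and>
        (\<forall>w' \<in> walks (nodes n) v.
           set (take (Suc hops) w') \<inter> suspects n (rep (hd w)) = {} \<longrightarrow>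
           set (drop hops w') \<inter> F = {} \<longrightarrow>
           w' ! hops \<in> reach n E (hd w) (suspects n (rep (hd w)) \<union> F) \<longrightarrow>
           (m, w', [reported n (rep (hd w)) (hd w')]) \<in> K))"

text \<open>The bounds range over all hypothetical fault sets S; the hypothesis that S is the actual fault
  set makes them valid.\<close>

definition hyps :: "nat \<Rightarrow> nat set set" where
  "hyps v = {S. S \<subseteq> nodes n \<and> card S \<le> f \<and> v \<notin> S}"

definition vals :: "nat \<Rightarrow> token set \<Rightarrow> nat set \<Rightarrow> real set" where
  "vals m K S = {a. \<exists>w. (m, w, [a]) \<in> K \<and> set w \<inter> S = {}}"

definition low :: "nat \<Rightarrow> nat \<Rightarrow> token set \<Rightarrow> real" where
  "low m v K = Max ((\<lambda>S. Min (vals m K S)) ` hyps v)"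

definition high :: "nat \<Rightarrow> nat \<Rightarrow> token set \<Rightarrow> real" where
  "high m v K = Min ((\<lambda>S. Max (vals m K S)) ` hyps v)"

lemma finite_hyps: "finite (hyps v)"
  by (rule finite_subset[of _ "Pow (nodes n)"]) (auto simp: hyps_def)

lemma finite_vals: "finite K \<Longrightarrow> finite (vals m K S)"
proof -
  assume "finite K"
  have "vals m K S \<subseteq> (\<lambda>(m, w, p). hd p) ` K" by (force simp: vals_def)
  with \<open>finite K\<close> show ?thesis by (meson finite_imageI finite_subset)
qed

lemma low_ge:
  assumes "S \<in> hyps v" "finite K" "vals m K S \<noteq> {}" "\<And>a. a \<in> vals m K S \<Longrightarrow> c \<le> a"
  shows "c \<le> low m v K"
proof -
  have "c \<le> Min (vals m K S)" using assms finite_vals by simp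
  also have "\<dots> \<le> low m v K" unfolding low_def using assms finite_hyps by (intro Max_ge) auto
  finally show ?thesis .
qed

lemma high_le:
  assumes "S \<in> hyps v" "finite K" "vals m K S \<noteq> {}" "\<And>a. a \<in> vals m K S \<Longrightarrow> a \<le> c"
  shows "high m v K \<le> c"
proof -
  have "high m v K \<le> Max (vals m K S)" unfolding high_def using assms finite_hyps by (intro Min_le) auto
  also have "\<dots> \<le> c" using assms finite_vals by simp
  finally show ?thesis .
qed

text \<open>A value common to two hypotheses lies above the minimum for one and below the maximum
  for the other.\<close>

lemma low_le_high:
  assumes "finite K" "finite K'" "hyps v \<noteq> {}" "hyps u \<noteq> {}"
    and "\<And>S S'. S \<in> hyps v \<Longrightarrow> S' \<in> hyps u \<Longrightarrow> vals m K S \<inter> vals m K' S' \<noteq> {}"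
  shows "low m v K \<le> high m u K'"
proof -
  have "Min (vals m K S) \<le> Max (vals m K' S')" if SS: "S \<in> hyps v" "S' \<in> hyps u" for S S'
  proof -
    obtain a where "a \<in> vals m K S" "a \<in> vals m K' S'" using assms(5)[OF SS] by blast
    thus ?thesis using finite_vals assms(1,2) by (meson Max_ge Min_le order_trans)
  qed
  thus ?thesis unfolding low_def high_def using finite_hyps assms(3,4) by (auto simp: Max_le_iff Min_ge_iff)
qed

section \<open>Items and the algorithm\<close>

definition ready :: "nat \<Rightarrow> nat \<Rightarrow> token set \<Rightarrow> bool" where
  "ready m v K \<longleftrightarrow> (if even m then \<exists>p. witness m v K p else \<exists>F rep. verified (m - 1) v K F rep)"

text \<open>As in \<open>ready\<close>, \<open>m\<close> is one less than the index of the item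
  produced: an even \<open>m\<close> leads to a report on the values with index \<open>m\<close>, an
  odd \<open>m\<close> to new values computed from those with index \<open>m - 1\<close>.\<close>

definition payload :: "nat \<Rightarrow> nat \<Rightarrow> token set \<Rightarrow> real list" where
  "payload m v K = (if even m then SOME p. witness m v K p
     else [(low (m - 1) v K + high (m - 1) v K) / 2])"

lemma ready_mono: "ready m v K \<Longrightarrow> K \<subseteq> K' \<Longrightarrow> ready m v K'"
  unfolding ready_def witness_def verified_def
  by (cases "even m"; simp; blast)

text \<open>The shortest sufficient prefix of the history fixes the item for good, so a node that
  recomputes it later never contradicts itself.\<close>

fun own :: "nat \<Rightarrow> real \<Rightarrow> nat \<Rightarrow> (nat \<times> msg) list \<Rightarrow> real list \<Rightarrow> bool" where
  "own v a 0 h p \<longleftrightarrow> p = [arctan a]"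
| "own v a (Suc m) h p \<longleftrightarrow> (\<exists>k \<le> length h. ready m v (received v (take k h)) \<and>
     (\<forall>k' < k. \<not> ready m v (received v (take k' h))) \<and> p = payload m v (received v (take k h)))"

lemma own_take: "own v a m (take l h) p \<Longrightarrow> own v a m h p"
proof (cases m)
  case (Suc m')
  assume "own v a m (take l h) p"
  then obtain k where k: "k \<le> length (take l h)" "ready m' v (received v (take k (take l h)))"
     "\<forall>k' < k. \<not> ready m' v (received v (take k' (take l h)))"
     "p = payload m' v (received v (take k (take l h)))" by (auto simp: Suc)
  have "take k' (take l h) = take k' h" if "k' \<le> k" for k' using that k(1) by (simp add: min_absorb1)
  with k show ?thesis by (auto simp: Suc intro!: exI[of _ k])
qed simp

lemma own_unique: "own v a m h p \<Longrightarrow> own v a m h p' \<Longrightarrow> p = p'"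
  by (cases m) (auto, metis nat_neq_iff)

lemma own_exists: "ready m v (received v h) \<Longrightarrow> \<exists>p. own v a (Suc m) h p"
proof -
  assume r: "ready m v (received v h)"
  let ?P = "\<lambda>k. ready m v (received v (take k h))"
  have "?P (length h)" using r by simp
  hence "?P (LEAST k. ?P k)" "(LEAST k. ?P k) \<le> length h" by (rule LeastI, rule Least_le)
  thus ?thesis by (auto dest: not_less_Least intro!: exI[of _ "LEAST k. ?P k"])
qed

definition holds :: "nat \<Rightarrow> real \<Rightarrow> (nat \<times> msg) list \<Rightarrow> token \<Rightarrow> bool" where
  "holds v a h = (\<lambda>(m, w, p). (m, w, p) \<in> received v h \<or> w = [v] \<and> own v a m h p)"

lemma holds_take: "holds v a (take l h) z \<Longrightarrow> holds v a h z"
  using received_mono[of "take l h" h v] set_take_subset[of l h]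
  by (auto simp: holds_def dest: own_take split: prod.splits)

text \<open>A step may send only finitely many messages although rounds are unbounded. Item
  \<open>m + 1\<close> requires a received token of item \<open>m\<close> along the constant walk at
  \<open>v\<close>, and only finitely many tokens have been received.\<close>

lemma finite_own: 
  assumes "v \<in> nodes n"
  shows "finite {(m, p). own v a m h p}"
proof -
  let ?M = "insert 0 (Suc ` fst ` received v h \<union> fst ` received v h)"
  have "m \<in> ?M" if m: "own v a m h p" for m p
  proof (cases m)
    case (Suc m')
    then obtain k where "ready m' v (received v (take k h))" using m by auto
    hence r: "ready m' v (received v h)"
      by (rule ready_mono) (intro received_mono set_take_subset)
    show ?thesis
    proof (cases "even m'")
      case True
      then obtain q where "witness m' v (received v h) q" using r by (auto simp: ready_def)
      moreover from this have "replicate (Suc (2 * hops)) v \<in> walks (nodes n - suspects n q) v"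
        using assms by (intro walks_refl) (auto simp: witness_def)
      ultimately have "\<exists>w q. (m', w, q) \<in> received v h" by (auto simp: witness_def)
      thus ?thesis using Suc by force
    next
      case False
      then obtain F rep where "verified (m' - 1) v (received v h) F rep" using r by (auto simp: ready_def)
      moreover from this have "replicate (Suc (2 * hops)) v \<in> walks (nodes n - F) v"
        using assms by (intro walks_refl) (auto simp: verified_def)
      ultimately have "\<exists>w q. (Suc (m' - 1), w, q) \<in> received v h" unfolding verified_def by blast
      moreover have "Suc (m' - 1) = m'" using False by (cases m') auto
      ultimately show ?thesis using Suc by force
    qed
  qed simp
  moreover have "(THE p. own v a m h p) = p" if "own v a m h p" for m p
    using that own_unique by blast
  ultimately have "{(m, p). own v a m h p} \<subseteq> (\<lambda>m. (m, THE p. own v a m h p)) ` ?M"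
    by (clarify, intro image_eqI) auto
  moreover have "finite ?M" using finite_received by blast
  ultimately show ?thesis by (meson finite_imageI finite_subset)
qed

lemma finite_holds: "v \<in> nodes n \<Longrightarrow> finite {z. holds v a h z}"
proof -
  assume v: "v \<in> nodes n"
  have "{z. holds v a h z} \<subseteq> received v h \<union> (\<lambda>(m, p). (m, [v], p)) ` {(m, p). own v a m h p}"
    by (auto simp: holds_def image_iff split: prod.splits)
  thus ?thesis using finite_received finite_own[OF v] by (meson finite_Un finite_imageI finite_subset)
qed

text \<open>At every step all held tokens are sent again to all neighbours and to the node itself.
  Repetitions are harmless since \<open>received\<close> is a set; \<open>finite_holds\<close> makes
  the required list exist.\<close>

definition alg :: send_fn where
  "alg v a h = (SOME l. set l = {(j, enc z) | j z. j \<in> nodes n \<and> link v j \<and> holds v a h z})"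

lemma set_alg:
  assumes "v \<in> nodes n"
  shows "set (alg v a h) = {(j, enc z) | j z. j \<in> nodes n \<and> link v j \<and> holds v a h z}"
proof -
  let ?S = "{(j, enc z) | j z. j \<in> nodes n \<and> link v j \<and> holds v a h z}"
  have "?S \<subseteq> nodes n \<times> enc ` {z. holds v a h z}" by auto
  hence "finite ?S" using finite_holds[OF assms] by (meson finite_SigmaI finite_atLeastAtMost finite_imageI finite_subset)
  hence "\<exists>l. set l = ?S" by (rule finite_list)
  thus ?thesis unfolding alg_def by (rule someI_ex)
qed

end

lemma view_take: "view (take k h) = take k (view h)"
  by (simp add: view_def take_map)

lemma view_hist_prefix:
  "t \<le> t' \<Longrightarrow> view (hist e v t) = take (length (hist e v t)) (view (hist e v t'))"
  using take_hist[of t t' "length (hist e v t)" e v] by (simp flip: view_take)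

lemma in_view_hist_iff:
  "(s, m) \<in> set (view (hist e j t)) \<longleftrightarrow> (\<exists>t' < t. \<exists>g. e t' j = Some (s, g, m))"
  by (force simp: view_def in_set_hist_iff)

section \<open>Consequences of verified reports, and the decision rule\<close>

context network
begin

lemma reach3D:
  assumes "u \<in> nodes n" "v \<in> nodes n" "F \<subseteq> nodes n" "Fu \<subseteq> nodes n" "Fv \<subseteq> nodes n"
    "card F \<le> f" "card Fu \<le> f" "card Fv \<le> f" "u \<notin> F \<union> Fu" "v \<notin> F \<union> Fv"
  obtains y where "y \<in> reach n E v (F \<union> Fv)" "y \<in> reach n E u (F \<union> Fu)"
proof -
  note r = reach3[unfolded three_reach_def, THEN bspec, OF assms(1), THEN bspec, OF assms(2),
    THEN spec, THEN spec, THEN spec, THEN mp]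
  have "reach n E v (F \<union> Fv) \<inter> reach n E u (F \<union> Fu) \<noteq> {}"
    by (rule r) (use assms(3-) in simp)
  thus thesis using that by blast
qed

lemma suspects_sub: "suspects n p \<subseteq> nodes n"
  by (auto simp: suspects_def)

lemma reach_walks:
  assumes "u \<in> reach n E v F" "v \<in> nodes n - F"
  obtains w where "w \<in> walks (nodes n - F) v" "hd w = u"
proof -
  obtain P where P: "length P = Suc hops" "hd P = u" "last P = v" "set P \<subseteq> nodes n - F"
    "successively link P" using assms(1) by (rule reach_walk)
  let ?Q = "replicate (Suc hops) v"
  have Q: "length ?Q = Suc hops" "successively link ?Q" "hd ?Q = v"
    using successively_replicate[of "Suc hops"] by (auto simp del: replicate_Suc)
  have "P @ tl ?Q \<in> walks (nodes n - F) v"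
    using glue_walks[OF P(1,5,3) Q] P(4) assms(2) by (auto simp: walks_def)
  thus thesis using that glue_walks(3)[OF P(1,5,3) Q] P(2) by metis
qed

text \<open>The value that y reports about z survives at v under the hypothesis S, since it also reaches v
  along a walk through q that avoids S.\<close>

lemma verified_vals:
  assumes ver: "verified m v K F rep" and v: "v \<in> nodes n" "v \<notin> S"
    and y: "y \<in> reach n E v F"
    and q: "q \<in> reach n E y (F \<union> suspects n (rep y))" "q \<in> reach n E v (F \<union> S)"
    and z: "z \<in> reach n E q (suspects n (rep y) \<union> S)"
  shows "reported n (rep y) z \<in> vals m K S"
proof -
  have vF: "v \<in> nodes n - F" using ver v by (auto simp: verified_def)
  obtain w where w: "w \<in> walks (nodes n - F) v" "hd w = y" using reach_walks[OF y vF] .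
  obtain P where P: "length P = Suc hops" "hd P = z" "last P = q"
    "set P \<subseteq> nodes n - (suspects n (rep y) \<union> S)" "successively link P" using z by (rule reach_walk)
  obtain Q where Q: "length Q = Suc hops" "hd Q = q" "last Q = v"
    "set Q \<subseteq> nodes n - (F \<union> S)" "successively link Q" using q(2) by (rule reach_walk)
  note g = glue_walks[OF P(1,5,3) Q(1,5,2)]
  \<comment> \<open>The first half avoids the suspects of \<open>y\<close>, the second half avoids
    \<open>F\<close>, and the glue node reaches \<open>y\<close>: the pattern that
    \<open>verified\<close> waits for. Both halves avoid \<open>S\<close>.\<close>
  let ?w = "P @ tl Q"
  have "?w \<in> walks (nodes n) v" using g P Q by (auto simp: walks_def)
  moreover have "set (take (Suc hops) ?w) \<inter> suspects n (rep (hd w)) = {}"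
    unfolding g(6) w(2) using P(4) by blast
  moreover have "set (drop hops ?w) \<inter> F = {}"
    unfolding g(7) using Q(4) by blast
  moreover have "?w ! hops \<in> reach n E (hd w) (suspects n (rep (hd w)) \<union> F)"
    unfolding g(8) w(2) using q(1) by (simp add: Un_commute)
  ultimately have "(m, ?w, [reported n (rep (hd w)) (hd ?w)]) \<in> K"
    using ver w(1) unfolding verified_def by blast
  moreover have "set ?w \<inter> S = {}" unfolding g(5) using P(4) Q(4) by blast
  ultimately show ?thesis unfolding g(3) w(2) P(2) vals_def by blast
qed

text \<open>\<open>4 / 2 ^ r\<close> bounds the distance from a nonfaulty value of round
  \<open>r\<close> to any nonfaulty value of that or a later round, see
  \<open>val_close\<close>.\<close>

definition tight :: "real \<Rightarrow> nat \<Rightarrow> real \<Rightarrow> bool" where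
  "tight \<epsilon> r y \<longleftrightarrow> (\<forall>z. \<bar>z - y\<bar> \<le> 4 / 2 ^ r \<longrightarrow> \<bar>tan z - tan y\<bar> \<le> \<epsilon>)"

definition decision :: "real \<Rightarrow> nat \<Rightarrow> real \<Rightarrow> (nat \<times> msg) list \<Rightarrow> real \<Rightarrow> bool" where
  "decision \<epsilon> v a h y \<longleftrightarrow> (\<exists>r. own v a (2 * r) h [y] \<and> tight \<epsilon> r y)"

definition dec :: "real \<Rightarrow> dec_fn" where
  "dec \<epsilon> v a h =
     (if Ex (decision \<epsilon> v a h) then Some (tan (Eps (decision \<epsilon> v a h))) else None)"

end

subsection \<open>Executions of the algorithm\<close>

locale run = network +
  fixes T :: "nat set" and x :: "nat \<Rightarrow> real" and e :: schedule
  assumes T_sub: "T \<subseteq> nodes n" and card_T: "card T \<le> f"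
    and adm: "admissible n E alg T x e"
begin

definition hon :: "nat set" where
  "hon = nodes n - T"

lemma finite_hon: "finite hon"
  by (simp add: hon_def)

text \<open>Held tokens are never lost, so time can be quantified away and asynchrony disappears
  from the later arguments.\<close>

definition has :: "nat \<Rightarrow> nat list \<Rightarrow> real list \<Rightarrow> bool" where
  "has m w p \<longleftrightarrow> w \<noteq> [] \<and> (\<exists>t. holds (last w) (x (last w)) (view (hist e (last w) t)) (m, w, p))"

abbreviation rcvd :: "nat \<Rightarrow> nat \<Rightarrow> token set" where
  "rcvd v t \<equiv> received v (view (hist e v t))"

lemma rcvd_mono: "t \<le> t' \<Longrightarrow> rcvd v t \<subseteq> rcvd v t'"
  using view_hist_prefix[of t t' e v] by (intro received_mono) (simp add: set_take_subset)

lemma has_append: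
  "w \<noteq> [] \<Longrightarrow> has m (w @ [j]) p \<longleftrightarrow> (\<exists>t. (m, w @ [j], p) \<in> rcvd j t)"
  by (simp add: has_def holds_def)

lemma has_own: "has m [v] p \<longleftrightarrow> (\<exists>t. own v (x v) m (view (hist e v t)) p)"
  by (simp add: has_def holds_def in_received)

text \<open>Messages of nonfaulty senders are authentic, and the algorithm sends only tokens that it
  holds. Earlier nodes of the walk may be faulty.\<close>

lemma has_pred:
  assumes "has m (w @ [j]) p" "w \<noteq> []" "last w \<notin> T"
  shows "has m w p" "last w \<in> hon"
proof -
  obtain t where "(m, w @ [j], p) \<in> rcvd j t" using assms has_append by blast
  then obtain t' k idx where t': "e t' j = Some (last w, (k, idx), enc (m, w, p))"
    by (auto simp: in_received in_view_hist_iff)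
  show hon: "last w \<in> hon" using admissible_edge[OF adm t'] assms(3) by (auto simp: hon_def)
  from admissible_authentic[OF adm t' assms(3)]
  have "(j, enc (m, w, p)) \<in> set (sent alg x e (last w) t' k)" by (metis nth_mem)
  hence "holds (last w) (x (last w)) (take k (view (hist e (last w) t'))) (m, w, p)"
    using hon by (auto simp: sent_def set_alg hon_def view_take)
  thus "has m w p" unfolding has_def using assms(2) holds_take by blast
qed

lemma has_step:
  assumes "has m w p" "last w \<in> hon" "j \<in> hon" "link (last w) j"
  shows "has m (w @ [j]) p"
proof -
  let ?s = "last w"
  obtain t where w: "w \<noteq> []" "holds ?s (x ?s) (view (hist e ?s t)) (m, w, p)"
    using assms(1) by (auto simp: has_def)
  have "(j, enc (m, w, p)) \<in> set (sent alg x e ?s t (length (hist e ?s t)))"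
    using w assms(2-4) by (auto simp: sent_def set_alg hon_def)
  then obtain t' g where "e t' j = Some (?s, g, enc (m, w, p))"
    using admissible_delivers[OF adm, of ?s "length (hist e ?s t)" t j "enc (m, w, p)"] assms(2-4)
    by (auto simp: hon_def link_def)
  hence "(m, w @ [j], p) \<in> rcvd j (Suc t')"
    using w(1) by (auto simp: in_received in_view_hist_iff)
  thus ?thesis using has_append w(1) by blast
qed

text \<open>Forward by reliable delivery, backward by \<open>has_pred\<close>. Faulty nodes may
  occur in \<open>w\<close> before its end.\<close>

lemma has_extend:
  assumes "w \<noteq> []" "last w \<in> hon" "set w' \<subseteq> hon" "successively link (last w # w')"
  shows "has m (w @ w') p \<longleftrightarrow> has m w p"
  using assms
proof (induction w' arbitrary: w)
  case (Cons j w')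
  have "has m (w @ [j]) p \<longleftrightarrow> has m w p"
    using Cons.prems has_step has_pred(1) by (auto simp: hon_def successively_Cons)
  moreover have "has m ((w @ [j]) @ w') p \<longleftrightarrow> has m (w @ [j]) p"
    using Cons.prems by (intro Cons.IH) (auto simp: successively_Cons)
  ultimately show ?case by simp
qed simp

lemma has_honest_walk:
  assumes "w \<noteq> []" "set w \<subseteq> hon" "successively link w"
  shows "has m w p \<longleftrightarrow> has m [hd w] p"
  using has_extend[of "[hd w]" "tl w" m p] assms by (cases w) auto

lemma has_origin:
  assumes "has m w p" "set w \<inter> T = {}" "last w \<in> hon"
  shows "hd w \<in> hon \<and> has m [hd w] p"
  using assms
proof (induction w rule: rev_induct)
  case (snoc j w)
  show ?case
  proof (cases "w = []")
    case False
    hence "last w \<notin> T" using snoc.prems(2) last_in_set by fastforce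
    note pred = has_pred[OF snoc.prems(1) False this]
    have "hd w \<in> hon \<and> has m [hd w] p"
      using pred snoc.prems(2) by (intro snoc.IH) auto
    thus ?thesis using False by simp
  qed (use snoc in auto)
qed (simp add: has_def)

lemma item_unique: "has m [v] p \<Longrightarrow> has m [v] p' \<Longrightarrow> p = p'"
proof -
  assume "has m [v] p" "has m [v] p'"
  then obtain t t' where t: "own v (x v) m (view (hist e v t)) p" "own v (x v) m (view (hist e v t')) p'"
    by (auto simp: has_own)
  let ?t = "max t t'"
  have "own v (x v) m (view (hist e v ?t)) p" "own v (x v) m (view (hist e v ?t)) p'"
    using t view_hist_prefix[of t ?t e v] view_hist_prefix[of t' ?t e v]
    by (auto simp del: own.simps intro: own_take)
  thus ?thesis by (rule own_unique)
qed

lemma item_0: "has 0 [v] p \<longleftrightarrow> p = [arctan (x v)]"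
  by (simp add: has_own)

definition held :: "nat \<Rightarrow> token set" where
  "held v = {(m, w, p). has m w p \<and> last w = v}"

lemma rcvd_held: "rcvd v t \<subseteq> held v"
proof
  fix z assume z: "z \<in> rcvd v t"
  obtain m w p where [simp]: "z = (m, w, p)" by (cases z)
  obtain w' where w: "w = w' @ [v]" "w' \<noteq> []" using z by (auto simp: in_received)
  hence "has m w p" using z has_append[OF w(2), of m v p] by auto
  thus "z \<in> held v" using w by (simp add: held_def)
qed

lemma item_SucD:
  assumes "has (Suc m) [v] p"
  obtains K where "finite K" "K \<subseteq> held v" "ready m v K" "p = payload m v K"
proof -
  obtain t k where tk: "ready m v (received v (take k (view (hist e v t))))"
    "p = payload m v (received v (take k (view (hist e v t))))"
    using assms by (auto simp: has_own)
  have "received v (take k (view (hist e v t))) \<subseteq> rcvd v t"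
    by (intro received_mono set_take_subset)
  hence "received v (take k (view (hist e v t))) \<subseteq> held v" using rcvd_held by blast
  from that[OF finite_received this tk] show thesis .
qed

text \<open>Finitely many tokens have all arrived by some common time, and readiness persists when
  more come in. The length condition confines \<open>K\<close> to received tokens, as opposed to own
  items.\<close>

lemma item_SucI:
  assumes "finite K" "ready m v K" "\<And>m w p. (m, w, p) \<in> K \<Longrightarrow> has m w p \<and> last w = v \<and> length w > 1"
  obtains p where "has (Suc m) [v] p"
proof -
  have "\<exists>t. z \<in> rcvd v t" if "z \<in> K" for z
  proof -
    obtain m w p where z: "z = (m, w, p)" by (cases z)
    with assms(3) that have w: "has m w p" "last w = v" "length w > 1" by auto
    have "length (butlast w) > 0" using w(3) by simp
    hence "butlast w \<noteq> []" by blast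
    moreover have "butlast w @ [v] = w" using w append_butlast_last_id[of w] by (cases w) auto
    ultimately show ?thesis using has_append[of "butlast w" m v p] w(1) z by simp
  qed
  then obtain \<tau> where \<tau>: "\<And>z. z \<in> K \<Longrightarrow> z \<in> rcvd v (\<tau> z)" by metis
  obtain t where t: "\<And>z. z \<in> K \<Longrightarrow> \<tau> z \<le> t"
    using assms(1) finite_nat_set_iff_bounded_le[of "\<tau> ` K"] by auto
  have "K \<subseteq> rcvd v t" using \<tau> t rcvd_mono by blast
  with assms(2) have "ready m v (rcvd v t)" by (rule ready_mono)
  hence "\<exists>p. own v (x v) (Suc m) (view (hist e v t)) p" by (rule own_exists)
  thus thesis using that has_own by blast
qed

section \<open>Progress of the rounds\<close>

lemma walks_props:
  assumes "w \<in> walks X v"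
  shows "w \<noteq> []" "length w > 1" "last w = v" "hd w \<in> X" "set w \<subseteq> X" "successively link w"
proof -
  show ne: "w \<noteq> []" "length w > 1" "last w = v" "set w \<subseteq> X" "successively link w"
    using assms by (auto simp: walks_def hops_def)
  show "hd w \<in> X" using ne hd_in_set by blast
qed

lemma report_item:
  assumes "even m" "has (Suc m) [y] p" "y \<in> hon"
  shows "card (suspects n p) \<le> f" "y \<notin> suspects n p"
    "\<And>w. w \<in> walks (nodes n - suspects n p) y \<Longrightarrow> has m w [reported n p (hd w)]"
proof -
  obtain K where K: "K \<subseteq> held y" "ready m y K" "p = payload m y K"
    using assms(2) by (rule item_SucD)
  hence wit: "witness m y K p" using assms(1) by (auto simp: ready_def payload_def intro: someI_ex)
  show "card (suspects n p) \<le> f" "y \<notin> suspects n p" using wit by (auto simp: witness_def)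
  show "has m w [reported n p (hd w)]" if "w \<in> walks (nodes n - suspects n p) y" for w
    using wit that K(1) by (auto simp: witness_def held_def)
qed

lemma value_item:
  assumes "even m" "has (Suc (Suc m)) [v] p"
  obtains K F rep where "finite K" "K \<subseteq> held v" "verified m v K F rep"
    "p = [(low m v K + high m v K) / 2]"
proof -
  obtain K where "finite K" "K \<subseteq> held v" "ready (Suc m) v K" "p = payload (Suc m) v K"
    using assms(2) by (rule item_SucD)
  thus thesis using that assms(1) by (auto simp: ready_def payload_def)
qed

lemma report_progress:
  assumes "even m" "\<And>y. y \<in> hon \<Longrightarrow> \<exists>a. has m [y] [a]" "v \<in> hon"
  obtains p where "has (Suc m) [v] p"
proof -
  obtain g where g: "\<And>y. y \<in> hon \<Longrightarrow> has m [y] [g y]" using assms(2) by metis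
  obtain p where p: "suspects n p = T" "\<And>z. z \<in> nodes n \<Longrightarrow> reported n p z = g z"
    by (rule report_exists[OF T_sub, where g = g]) (rule that)
  \<comment> \<open>The true values along all fault-free walks, which are bound to arrive.\<close>
  let ?K = "(\<lambda>w. (m, w, [reported n p (hd w)])) ` walks (nodes n - T) v"
  have "finite ?K" by (simp add: finite_walks)
  moreover have "witness m v ?K p"
    using assms(3) card_T by (auto simp: witness_def p(1) hon_def)
  hence "ready m v ?K" using assms(1) by (auto simp: ready_def)
  moreover have "has m' w q \<and> last w = v \<and> length w > 1" if "(m', w, q) \<in> ?K" for m' w q
  proof -
    have w: "w \<in> walks (nodes n - T) v" "m' = m" "q = [reported n p (hd w)]" using that by auto
    note ww = walks_props[OF w(1)]
    have "has m [hd w] q" using g[of "hd w"] p(2)[of "hd w"] ww(4) w(3) by (auto simp: hon_def)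
    thus ?thesis using ww w(2) has_honest_walk[of w m q] by (auto simp: hon_def)
  qed
  ultimately show thesis using item_SucI that by blast
qed

text \<open>With \<open>T\<close> as the suspected set all reporters are nonfaulty. What such a
  reporter received through a node \<open>q\<close> and then along a fault-free walk was held by
  \<open>q\<close>, which is nonfaulty and forwards it to \<open>v\<close>. The part before
  \<open>q\<close> may be faulty: the token must arrive, true or not.\<close>

lemma value_progress:
  assumes "even m" "\<And>y. y \<in> hon \<Longrightarrow> \<exists>p. has (Suc m) [y] p" "v \<in> hon"
  obtains p where "has (Suc (Suc m)) [v] p"
proof -
  obtain rep where rep: "\<And>y. y \<in> hon \<Longrightarrow> has (Suc m) [y] (rep y)" using assms(2) by metis
  let ?W = "walks (nodes n - T) v" and ?W' = "walks (nodes n) v"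
  define ok where "ok w w' \<longleftrightarrow> set (take (Suc hops) w') \<inter> suspects n (rep (hd w)) = {} \<and>
      set (drop hops w') \<inter> T = {} \<and> w' ! hops \<in> reach n E (hd w) (suspects n (rep (hd w)) \<union> T)" for w w'
  let ?K1 = "(\<lambda>w. (Suc m, w, rep (hd w))) ` ?W"
  let ?K2 = "(\<lambda>(w, w'). (m, w', [reported n (rep (hd w)) (hd w')])) ` {(w, w') \<in> ?W \<times> ?W'. ok w w'}"
  have "finite (?W \<times> ?W')" by (simp add: finite_walks)
  hence fin: "finite (?K1 \<union> ?K2)"
    by (intro finite_UnI finite_imageI) (auto simp: finite_walks intro: finite_subset[of _ "?W \<times> ?W'"])
  have "verified m v (?K1 \<union> ?K2) T rep"
    using assms(3) card_T T_sub by (auto simp: verified_def hon_def ok_def image_iff Bex_def)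
  hence rdy: "ready (Suc m) v (?K1 \<union> ?K2)" using assms(1) by (auto simp: ready_def)
  have K1: "has m' w q \<and> last w = v \<and> length w > 1" if "(m', w, q) \<in> ?K1" for m' w q
  proof -
    have w: "w \<in> walks (nodes n - T) v" "m' = Suc m" "q = rep (hd w)" using that by auto
    note ww = walks_props[OF w(1)]
    have "has (Suc m) [hd w] q" using rep[of "hd w"] ww(4) w(3) by (auto simp: hon_def)
    thus ?thesis using ww w(2) has_honest_walk[of w "Suc m" q] by (auto simp: hon_def)
  qed
  have K2: "has m' w' q \<and> last w' = v \<and> length w' > 1" if K2: "(m', w', q) \<in> ?K2" for m' w' q
  proof -
    obtain w where w: "w \<in> ?W" "w' \<in> ?W'" "ok w w'" "m' = m" "q = [reported n (rep (hd w)) (hd w')]"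
      using K2 by auto
    note ww = walks_props[OF w(1)] and ww' = walks_props[OF w(2)]
    let ?y = "hd w" and ?q = "w' ! hops" and ?P = "take (Suc hops) w'" and ?Q = "drop (Suc hops) w'"
    let ?p = "rep ?y"
    have y: "?y \<in> hon" using ww(4) by (simp add: hon_def)
    note R = report_item[OF assms(1) rep[OF y] y]
    have len: "length w' = Suc (2 * hops)" using w(2) by (simp add: walks_def)
    have split: "w' = ?P @ ?Q" by simp
    have drop: "drop hops w' = ?q # ?Q" using len by (simp add: Cons_nth_drop_Suc)
    have P: "length ?P = Suc hops" "last ?P = ?q" "?P \<noteq> []" "hd ?P = hd w'"
      using len ww'(1) by (auto simp: last_conv_nth)
    have sP: "successively link ?P" and sQ: "successively link (?q # ?Q)"
      using ww'(6) append_take_drop_id[of "Suc hops" w'] append_take_drop_id[of hops w']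
      unfolding drop[symmetric] by (metis successively_append_iff)+
    have Qhon: "set (?q # ?Q) \<subseteq> hon"
      using w(3) ww'(5) set_drop_subset[of hops w'] unfolding ok_def drop[symmetric] hon_def by blast
    have "?q \<in> reach n E ?y (suspects n ?p \<union> T)" using w(3) by (simp add: ok_def)
    then obtain R' where R': "length R' = Suc hops" "hd R' = ?q" "last R' = ?y"
      "set R' \<subseteq> nodes n - (suspects n ?p \<union> T)" "successively link R'" by (rule reach_walk)
    note g = glue_walks[OF P(1) sP P(2) R'(1,5,2)]
    have "set ?P \<subseteq> nodes n - suspects n ?p"
      using w(3) ww'(5) set_take_subset[of "Suc hops" w'] unfolding ok_def by blast
    hence "?P @ tl R' \<in> walks (nodes n - suspects n ?p) ?y"
      using g(1,2,4,5) R'(3,4) by (auto simp: walks_def)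
    \<comment> \<open>The detour avoids the suspects of the reporter, so its report vouches for this
      token. Going back along \<open>R'\<close> and forward along \<open>?Q\<close> transfers the
      token to \<open>w'\<close>.\<close>
    hence "has m (?P @ tl R') q" using R(3) g(3) P(4) w(5) by metis
    moreover have "has m (?P @ tl R') q \<longleftrightarrow> has m ?P q"
    proof (rule has_extend)
      show "?P \<noteq> []" by (fact P(3))
      show "last ?P \<in> hon" using Qhon P(2) by simp
      have "R' = last ?P # tl R'" using R'(1,2) P(2) by (cases R') auto
      thus "successively link (last ?P # tl R')" using R'(5) by simp
      show "set (tl R') \<subseteq> hon" using R'(1,4) by (cases R') (auto simp: hon_def)
    qed
    moreover have "has m (?P @ ?Q) q \<longleftrightarrow> has m ?P q"
      using P sQ Qhon by (intro has_extend) auto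
    ultimately have "has m w' q" using split by metis
    thus ?thesis using ww' w(4) by simp
  qed
  show thesis
    by (rule item_SucI[OF fin rdy]) (use K1 K2 that in blast)+
qed

text \<open>The common set in the uses of \<open>reach3D\<close> is in turn \<open>T\<close>,
  \<open>F\<close>, \<open>F'\<close> and the suspects of \<open>y\<close>. The sets
  \<open>F\<close>, \<open>F'\<close>, \<open>S\<close>, \<open>S'\<close> are mere guesses and may
  miss all actual faults.\<close>

lemma vals_overlap:
  assumes m: "even m" and v: "v \<in> hon" and u: "u \<in> hon"
    and K: "K \<subseteq> held v" "verified m v K F rep" and K': "K' \<subseteq> held u" "verified m u K' F' rep'"
    and S: "S \<in> hyps v" and S': "S' \<in> hyps u"
  shows "vals m K S \<inter> vals m K' S' \<noteq> {}"
proof -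
  have F: "F \<subseteq> nodes n" "card F \<le> f" "v \<notin> F" "F' \<subseteq> nodes n" "card F' \<le> f" "u \<notin> F'"
    using K K' by (auto simp: verified_def)
  have SS: "S \<subseteq> nodes n" "card S \<le> f" "v \<notin> S" "S' \<subseteq> nodes n" "card S' \<le> f" "u \<notin> S'"
    using S S' by (auto simp: hyps_def)
  have vu: "v \<in> nodes n" "v \<notin> T" "u \<in> nodes n" "u \<notin> T" using v u by (auto simp: hon_def)
  \<comment> \<open>Common set \<open>T\<close>: fault-free walks lead from \<open>y\<close> to both
    nodes, so both hold the genuine report of \<open>y\<close>, and \<open>rep\<close> and
    \<open>rep'\<close> agree there.\<close>
  obtain y where y: "y \<in> reach n E v (T \<union> F)" "y \<in> reach n E u (T \<union> F')"
    using reach3D[of u v T F' F] vu F T_sub card_T by auto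
  have true_rep: "has (Suc m) [y] (r y)"
    if a: "y \<in> reach n E c (T \<union> G)" "c \<in> hon" "verified m c J G r" "J \<subseteq> held c" for c G r J
  proof -
    have c: "c \<in> nodes n - (T \<union> G)" using a by (auto simp: verified_def hon_def)
    obtain w where w: "w \<in> walks (nodes n - (T \<union> G)) c" "hd w = y"
      using reach_walks[OF a(1) c] .
    hence "w \<in> walks (nodes n - G) c" using walks_mono[of "nodes n - (T \<union> G)" "nodes n - G"] by blast
    hence "(Suc m, w, r y) \<in> J" using a(3) w(2) by (auto simp: verified_def)
    hence "has (Suc m) w (r y)" using a(4) by (auto simp: held_def)
    thus ?thesis using walks_props[OF w(1)] has_honest_walk[of w "Suc m" "r y"] w(2)
      by (auto simp: hon_def)
  qed
  have yh: "y \<in> hon" using y(1) by (auto simp: reach_def hon_def)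
  have rep: "has (Suc m) [y] (rep y)" "rep' y = rep y"
    using true_rep[OF y(1) v K(2,1)] true_rep[OF y(2) u K'(2,1)] item_unique by auto
  let ?B = "suspects n (rep y)"
  have B: "card ?B \<le> f" "y \<notin> ?B" "?B \<subseteq> nodes n"
    using report_item[OF m rep(1) yh] suspects_sub by auto
  have yr: "y \<in> nodes n" "y \<notin> F" "y \<notin> F'" using y by (auto simp: reach_def)
  \<comment> \<open>Common set \<open>F\<close>: through \<open>q\<close> tokens pass on to
    \<open>y\<close> outside its suspects and to \<open>v\<close> outside \<open>S\<close>, both
    outside \<open>F\<close>.\<close>
  obtain q where q: "q \<in> reach n E y (F \<union> ?B)" "q \<in> reach n E v (F \<union> S)"
    using reach3D[of v y F S ?B] vu yr F SS B by auto
  obtain q' where q': "q' \<in> reach n E y (F' \<union> ?B)" "q' \<in> reach n E u (F' \<union> S')"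
    using reach3D[of u y F' S' ?B] vu yr F SS B by auto
  have qq: "q \<in> nodes n" "q \<notin> ?B \<union> S" "q' \<in> nodes n" "q' \<notin> ?B \<union> S'"
    using q q' by (auto simp: reach_def)
  \<comment> \<open>Common set \<open>?B\<close>: one and the same entry of the report of
    \<open>y\<close> is confirmed to \<open>v\<close> through \<open>q\<close> and to
    \<open>u\<close> through \<open>q'\<close>.\<close>
  obtain z where z: "z \<in> reach n E q (?B \<union> S)" "z \<in> reach n E q' (?B \<union> S')"
    using reach3D[of q' q ?B S' S] qq SS B by auto
  have mono: "reach n E c (T \<union> G) \<subseteq> reach n E c G" for c G
    unfolding reach_def using rtrancl_mono[of "Restr E (nodes n - (T \<union> G))" "Restr E (nodes n - G)"]
    by blast
  have "reported n (rep y) z \<in> vals m K S"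
    using y mono by (intro verified_vals[OF K(2) vu(1) SS(3) _ q z(1)]) blast
  moreover have "reported n (rep' y) z \<in> vals m K' S'"
    using y mono q' z(2) rep(2) by (intro verified_vals[OF K'(2) vu(3) SS(6)]) auto
  ultimately show ?thesis using rep(2) by auto
qed

subsection \<open>Convergence\<close>

lemma value_exists: "v \<in> hon \<Longrightarrow> \<exists>a. has (2 * r) [v] [a]"
proof (induction r arbitrary: v)
  case 0
  thus ?case by (simp add: item_0)
next
  case (Suc r)
  have rp: "\<exists>p. has (Suc (2 * r)) [y] p" if "y \<in> hon" for y
    using report_progress[of "2 * r" y] Suc.IH that by (meson dvd_triv_left)
  obtain p where p: "has (Suc (Suc (2 * r))) [v] p"
    using value_progress[of "2 * r" v] rp Suc.prems by (meson dvd_triv_left)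
  then obtain a where "p = [a]" using value_item[of "2 * r" v p] by (metis dvd_triv_left)
  with p show ?case by auto
qed

definition val :: "nat \<Rightarrow> nat \<Rightarrow> real" where
  "val r v = (THE a. has (2 * r) [v] [a])"

lemma val_eqI: "has (2 * r) [v] [a] \<Longrightarrow> val r v = a"
  unfolding val_def using item_unique by blast

lemma has_val: "v \<in> hon \<Longrightarrow> has (2 * r) [v] [val r v]"
  using value_exists val_eqI by metis

text \<open>Twice the difference of the midpoints is (low of v - high of u) + (high of v - low of
  u). The first summand is at most 0 by \<open>vals_overlap\<close>, the second at most
  \<open>hi - lo\<close> by the hypothesis \<open>T\<close>.\<close>

lemma val_step:
  assumes bounds: "\<And>y. y \<in> hon \<Longrightarrow> lo \<le> val r y \<and> val r y \<le> hi" and v: "v \<in> hon" and u: "u \<in> hon"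
  shows "lo \<le> val (Suc r) v" "val (Suc r) v \<le> hi"
    "val (Suc r) v - val (Suc r) u \<le> (hi - lo) / 2"
proof -
  define m where "m = 2 * r"
  have m: "even m" by (simp add: m_def)
  have V: "\<exists>K F rep. finite K \<and> K \<subseteq> held c \<and> verified m c K F rep \<and>
      val (Suc r) c = (low m c K + high m c K) / 2" if "c \<in> hon" for c
  proof -
    have h: "has (Suc (Suc m)) [c] [val (Suc r) c]" using has_val[OF that, of "Suc r"] by (simp add: m_def)
    show ?thesis by (rule value_item[OF m h]) auto
  qed
  have hyp: "T \<in> hyps c" if "c \<in> hon" for c using that T_sub card_T by (auto simp: hyps_def hon_def)
  have sound: "lo \<le> a \<and> a \<le> hi" if a: "a \<in> vals m K T" "K \<subseteq> held c" "c \<in> hon" for a K c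
  proof -
    obtain w where w: "has m w [a]" "last w = c" "set w \<inter> T = {}"
      using a(1,2) by (auto simp: vals_def held_def)
    with has_origin a(3) have "hd w \<in> hon" "has m [hd w] [a]" by blast+
    thus ?thesis using bounds val_eqI unfolding m_def by metis
  qed
  have one: "lo \<le> low m c K" "low m c K \<le> high m d K'" "high m c K \<le> hi"
    if "finite K" "K \<subseteq> held c" "verified m c K F rep" "c \<in> hon"
      "finite K'" "K' \<subseteq> held d" "verified m d K' F' rep'" "d \<in> hon" for c K F rep d K' F' rep'
  proof -
    \<comment> \<open>Nonemptiness comes from overlapping \<open>c\<close> with itself, both times
      under the hypothesis \<open>T\<close>.\<close>
    have ne: "vals m K T \<noteq> {}" using vals_overlap[OF m that(4,4,2,3,2,3) hyp hyp] that by auto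
    show "lo \<le> low m c K"
      using that sound by (intro low_ge[OF hyp]) (use ne in auto)
    show "high m c K \<le> hi"
      using that sound by (intro high_le[OF hyp]) (use ne in auto)
    show "low m c K \<le> high m d K'"
      by (rule low_le_high[OF that(1,5)]) (use that hyp vals_overlap[OF m that(4,8,2,3,6,7)] in blast)+
  qed
  obtain K F rep where K: "finite K" "K \<subseteq> held v" "verified m v K F rep"
    "val (Suc r) v = (low m v K + high m v K) / 2" using V[OF v] by blast
  obtain K' F' rep' where K': "finite K'" "K' \<subseteq> held u" "verified m u K' F' rep'"
    "val (Suc r) u = (low m u K' + high m u K') / 2" using V[OF u] by blast
  note a = one[OF K(1-3) v K(1-3) v] and b = one[OF K(1-3) v K'(1-3) u]
    and c = one[OF K'(1-3) u K(1-3) v]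
  show "lo \<le> val (Suc r) v" "val (Suc r) v \<le> hi" "val (Suc r) v - val (Suc r) u \<le> (hi - lo) / 2"
    using a b c K(4) K'(4) by (auto simp: field_simps)
qed

lemma val_bounds:
  assumes "\<And>y. y \<in> hon \<Longrightarrow> lo \<le> val r y \<and> val r y \<le> hi" "v \<in> hon" "r \<le> r'"
  shows "lo \<le> val r' v \<and> val r' v \<le> hi"
  using assms(3,2)
proof (induction r' arbitrary: v rule: dec_induct)
  case base
  thus ?case using assms(1) by blast
next
  case (step r')
  thus ?case using val_step[of lo r' hi v v] by blast
qed

lemma val_0: "val 0 v = arctan (x v)"
  by (rule val_eqI) (simp add: item_0)

lemma val_extremes:
  assumes "v \<in> hon"
  obtains a b where "a \<in> hon" "b \<in> hon"
    "\<And>y. y \<in> hon \<Longrightarrow> val r b \<le> val r y \<and> val r y \<le> val r a"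
proof -
  let ?A = "val r ` hon"
  have A: "finite ?A" "?A \<noteq> {}" using finite_hon assms by auto
  obtain a where a: "Max ?A = val r a" "a \<in> hon" using Max_in[OF A] by (rule imageE)
  obtain b where b: "Min ?A = val r b" "b \<in> hon" using Min_in[OF A] by (rule imageE)
  have "val r b \<le> val r y \<and> val r y \<le> val r a" if "y \<in> hon" for y
    using that A(1) by (simp flip: a(1) b(1))
  with a(2) b(2) show thesis by (rule that)
qed

text \<open>Initially the arctangents differ by less than pi, hence by less than 4; each round
  halves the distance between the extremes.\<close>

lemma val_diameter:
  assumes "v \<in> hon" "u \<in> hon"
  shows "val r v - val r u \<le> 4 / 2 ^ r"
  using assms
proof (induction r arbitrary: v u)
  case 0
  have "arctan (x v) < pi / 2" "arctan (x u) > - (pi / 2)" using arctan_bounded by auto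
  thus ?case using pi_less_4 by (simp add: val_0)
next
  case (Suc r)
  obtain a b where ab: "a \<in> hon" "b \<in> hon"
    "\<And>y. y \<in> hon \<Longrightarrow> val r b \<le> val r y \<and> val r y \<le> val r a"
    by (rule val_extremes[OF Suc.prems(1), of r]) (rule that)
  have "val (Suc r) v - val (Suc r) u \<le> (val r a - val r b) / 2"
    using ab(3) Suc.prems by (rule val_step(3))
  also have "val r a - val r b \<le> 4 / 2 ^ r" using Suc.IH[OF ab(1,2)] .
  finally show ?case by simp
qed

text \<open>All values of round \<open>r\<close> lie within \<open>4 / 2 ^ r\<close> of
  \<open>val r v\<close>, and later values never leave the range of round \<open>r\<close>.\<close>

lemma val_close:
  assumes "v \<in> hon" "u \<in> hon" "r \<le> r'"
  shows "\<bar>val r' u - val r v\<bar> \<le> 4 / 2 ^ r"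
proof -
  have "val r v - 4 / 2 ^ r \<le> val r y \<and> val r y \<le> val r v + 4 / 2 ^ r" if "y \<in> hon" for y
    using val_diameter[OF assms(1) that, of r] val_diameter[OF that assms(1), of r] by auto
  from val_bounds[OF this assms(2,3)] show ?thesis by (auto simp: abs_le_iff)
qed

section \<open>Decisions\<close>

lemma uniformly_tight:
  assumes "- (pi / 2) < lo" "hi < pi / 2" "\<epsilon> > 0"
  obtains r where "\<And>y. lo \<le> y \<Longrightarrow> y \<le> hi \<Longrightarrow> tight \<epsilon> r y"
proof -
  \<comment> \<open>Midpoints towards the poles of tan: on the larger compact interval tan is
    uniformly continuous, and the margin keeps \<open>z\<close> inside it.\<close>
  define lo' where "lo' = (lo - pi / 2) / 2"
  define hi' where "hi' = (hi + pi / 2) / 2"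
  have b: "- (pi / 2) < lo'" "lo' < lo" "hi < hi'" "hi' < pi / 2"
    using assms by (auto simp: lo'_def hi'_def field_simps)
  have "continuous_on {lo'..hi'} tan"
  proof (intro continuous_on_tan continuous_on_id ballI)
    fix z assume "z \<in> {lo'..hi'}"
    thus "cos z \<noteq> 0" using b cos_gt_zero_pi[of z] by auto
  qed
  hence "uniformly_continuous_on {lo'..hi'} tan" by (rule compact_uniformly_continuous) simp
  then obtain d where d: "d > 0"
    "\<And>y z. y \<in> {lo'..hi'} \<Longrightarrow> z \<in> {lo'..hi'} \<Longrightarrow> \<bar>z - y\<bar> < d \<Longrightarrow> \<bar>tan z - tan y\<bar> < \<epsilon>"
    using assms(3) unfolding uniformly_continuous_on_def dist_real_def by metis
  let ?d = "min d (min (lo - lo') (hi' - hi))"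
  have "?d > 0" using d b by simp
  then obtain r where r: "(1/2) ^ r < ?d / 4"
    using real_arch_pow_inv[of "?d / 4" "1/2"] by auto
  have r': "4 / 2 ^ r < ?d" using r by (simp add: power_one_over field_simps)
  have "tight \<epsilon> r y" if "lo \<le> y" "y \<le> hi" for y
    unfolding tight_def
  proof (intro allI impI)
    fix z assume z: "\<bar>z - y\<bar> \<le> 4 / 2 ^ r"
    hence "\<bar>z - y\<bar> < d" "\<bar>z - y\<bar> < lo - lo'" "\<bar>z - y\<bar> < hi' - hi" using r' by auto
    moreover from this have "z \<in> {lo'..hi'}" "y \<in> {lo'..hi'}" using that b by auto
    ultimately show "\<bar>tan z - tan y\<bar> \<le> \<epsilon>" using d(2)[of y z] by simp
  qed
  thus thesis by (rule that)
qed

lemma decided_out: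
  assumes "decided (dec \<epsilon>) x e v t"
  obtains r where "out_val (dec \<epsilon>) x e v = tan (val r v)" "tight \<epsilon> r (val r v)"
proof -
  let ?P = "decision \<epsilon> v (x v) (view (hist e v (LEAST t. decided (dec \<epsilon>) x e v t)))"
  have "decided (dec \<epsilon>) x e v (LEAST t. decided (dec \<epsilon>) x e v t)" using assms by (rule LeastI)
  hence ex: "Ex ?P" unfolding decided_def dec_def by presburger
  hence "?P (Eps ?P)" by (rule someI_ex)
  then obtain r where "has (2 * r) [v] [Eps ?P]" "tight \<epsilon> r (Eps ?P)"
    unfolding decision_def has_own by blast
  moreover from this have "val r v = Eps ?P" by (intro val_eqI)
  moreover have "out_val (dec \<epsilon>) x e v = tan (Eps ?P)"
    using ex by (simp add: out_val_def dec_def)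
  ultimately show thesis using that[of r] by simp
qed

lemma eventually_decided:
  assumes "v \<in> hon" "\<epsilon> > 0"
  shows "\<exists>t. decided (dec \<epsilon>) x e v t"
proof -
  obtain a b where ab: "a \<in> hon" "b \<in> hon"
    "\<And>y. y \<in> hon \<Longrightarrow> val 0 b \<le> val 0 y \<and> val 0 y \<le> val 0 a"
    by (rule val_extremes[OF assms(1), of 0]) (rule that)
  have "- (pi / 2) < val 0 b" "val 0 a < pi / 2"
    using arctan_bounded by (auto simp: val_0)
  \<comment> \<open>This \<open>r\<close> depends on the nonfaulty inputs. No node has to know it,
    as each node tests \<open>tight\<close> on its own value.\<close>
  then obtain r where r: "\<And>y. val 0 b \<le> y \<Longrightarrow> y \<le> val 0 a \<Longrightarrow> tight \<epsilon> r y"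
    using assms(2) by (rule uniformly_tight) (rule that)
  have "tight \<epsilon> r (val r v)"
    using r val_bounds[OF ab(3) assms(1), of r] by simp
  moreover obtain t where "own v (x v) (2 * r) (view (hist e v t)) [val r v]"
    using has_val[OF assms(1)] has_own by blast
  ultimately have "decision \<epsilon> v (x v) (view (hist e v t)) (val r v)" by (auto simp: decision_def)
  hence "Ex (decision \<epsilon> v (x v) (view (hist e v t)))" ..
  thus ?thesis unfolding decided_def dec_def by auto
qed

text \<open>The two nodes may decide in different rounds; tightness at the earlier round covers the
  value of the later one.\<close>

lemma agreement:
  assumes "v \<in> hon" "u \<in> hon" "\<epsilon> > 0"
  shows "\<bar>out_val (dec \<epsilon>) x e v - out_val (dec \<epsilon>) x e u\<bar> \<le> \<epsilon>"
proof -
  obtain r where r: "out_val (dec \<epsilon>) x e v = tan (val r v)" "tight \<epsilon> r (val r v)"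
    using eventually_decided[OF assms(1,3)] decided_out by metis
  obtain s where s: "out_val (dec \<epsilon>) x e u = tan (val s u)" "tight \<epsilon> s (val s u)"
    using eventually_decided[OF assms(2,3)] decided_out by metis
  show ?thesis
  proof (cases "r \<le> s")
    case True
    thus ?thesis using val_close[OF assms(1,2)] r s unfolding tight_def by (metis abs_minus_commute)
  next
    case False
    thus ?thesis using val_close[OF assms(2,1), of s r] r s unfolding tight_def by simp
  qed
qed

lemma validity:
  assumes "v \<in> hon" "\<epsilon> > 0"
  shows "(\<exists>j \<in> hon. x j \<le> out_val (dec \<epsilon>) x e v) \<and> (\<exists>j \<in> hon. out_val (dec \<epsilon>) x e v \<le> x j)"
proof -
  obtain r where r: "out_val (dec \<epsilon>) x e v = tan (val r v)"
    using eventually_decided[OF assms] decided_out by metis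
  obtain a b where ab: "a \<in> hon" "b \<in> hon"
    "\<And>y. y \<in> hon \<Longrightarrow> val 0 b \<le> val 0 y \<and> val 0 y \<le> val 0 a"
    by (rule val_extremes[OF assms(1), of 0]) (rule that)
  have "val 0 b \<le> val r v \<and> val r v \<le> val 0 a"
    using val_bounds[OF ab(3) assms(1), of r] by simp
  hence v: "arctan (x b) \<le> val r v" "val r v \<le> arctan (x a)" by (auto simp: val_0)
  have "tan (arctan (x b)) \<le> tan (val r v)" "tan (val r v) \<le> tan (arctan (x a))"
    using v arctan_bounded[of "x b"] arctan_bounded[of "x a"] by (auto intro!: tan_mono_le)
  thus ?thesis using ab r by (auto simp: tan_arctan)
qed

end

lemma (in network) consensus_possible: "approx_consensus_possible n E f"
  unfolding approx_consensus_possible_def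
proof (intro allI impI)
  fix \<epsilon> :: real assume "\<epsilon> > 0"
  show "\<exists>alg dec. \<forall>x T e. T \<subseteq> nodes n \<longrightarrow> card T \<le> f \<longrightarrow> admissible n E alg T x e \<longrightarrow>
            (\<forall>i \<in> nodes n - T. \<exists>t. decided dec x e i t) \<and>
            (\<forall>i \<in> nodes n - T. \<forall>j \<in> nodes n - T. \<bar>out_val dec x e i - out_val dec x e j\<bar> \<le> \<epsilon>) \<and>
            (\<forall>i \<in> nodes n - T. (\<exists>j \<in> nodes n - T. x j \<le> out_val dec x e i) \<and>
                                 (\<exists>j \<in> nodes n - T. out_val dec x e i \<le> x j))"
  proof (intro exI allI impI)
    fix x T e
    assume "T \<subseteq> nodes n" "card T \<le> f" "admissible n E alg T x e"
    then interpret run n f E T x e by unfold_locales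
    show "(\<forall>i \<in> nodes n - T. \<exists>t. decided (dec \<epsilon>) x e i t) \<and>
            (\<forall>i \<in> nodes n - T. \<forall>j \<in> nodes n - T. \<bar>out_val (dec \<epsilon>) x e i - out_val (dec \<epsilon>) x e j\<bar> \<le> \<epsilon>) \<and>
            (\<forall>i \<in> nodes n - T. (\<exists>j \<in> nodes n - T. x j \<le> out_val (dec \<epsilon>) x e i) \<and>
                                 (\<exists>j \<in> nodes n - T. out_val (dec \<epsilon>) x e i \<le> x j))"
      using eventually_decided agreement validity \<open>\<epsilon> > 0\<close> unfolding hon_def by blast
  qed
qed

theorem theorem2p7:
  fixes n f :: nat and E :: "(nat \<times> nat) set"
  assumes "E \<subseteq> nodes n \<times> nodes n"
    and "\<forall>i. (i, i) \<notin> E"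
  shows "approx_consensus_possible n E f \<longleftrightarrow> three_reach n E f"
proof
  assume "three_reach n E f"
  with assms(1) interpret network n f E by unfold_locales
  show "approx_consensus_possible n E f" by (rule consensus_possible)
qed (rule consensus_imp_three_reach)

end
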